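(* Let $P\in\mathsf{BM}_d$ be an irreducible GI/G/1-type stochastic matrix built from $\{A(k);k\in\mathbb{Z}\}$ and $\{B(k);k\in\mathbb{Z}_+\}$ as in the context, with $A=\sum_{k\in\mathbb{Z}}A(k)$ an irreducible stochastic matrix and $\sigma=\varpi\sum_{k\in\mathbb{Z}}kA(k)e<0$. Fix $N\in\mathbb{N}$ with $\sigma_N<0$ and $M\in\mathbb{N}$ with $\sum_{\ell=-L}^\infty\ell A_N^{*M}(\ell)e<0$ (entrywise), where $L=MN$. Let $V$ and $\alpha\in[0,1)$ satisfy the moment assumption (MA) of the context. Fix (1) $\kappa>0$ and $\varepsilon\in(0,1)$ such that $$(1-\varepsilon)\sum_{\ell=-L}^\infty\ell A_N^{*M}(\ell)e+2\varepsilon\sum_{\ell=0}^\infty\ell A_N^{*M}(\ell)e\le-2\kappa e;$$ (2) $\delta_0>0$ and an integer $K_0\ge L$ such that $V'(k+\delta_0k^{1-\alpha})\le(1+\varepsilon)V'(k)$ and $V'(k-L)\ge(1-\varepsilon)V'(k)$ for all integers $k\ge K_0+1$; (3) an integer $K\ge K_0$ such that $$\frac1{V'(k)}\sum_{\ell=\lfloor\delta_0k^{1-\alpha}\rfloor+1}^\infty V(k+\ell)A_N^{*M}(\ell)e\le\kappa e\quad\text{for all integers }k\ge K+1.$$ Let $$\phi(t)=\kappa V'(V^{-1}(t)),\qquad t\ge1,$$ where $V^{-1}$ denotes the inverse function of the increasing and differentiable function $V$ (so that $\phi(V(k))=\kappa V'(k)$ for $k\in\mathbb{Z}_+$), and let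 $$b=\inf\Big\{x\ge0:\ xe\ge\sum_{\ell=0}^\infty P_N^M(k;\ell)V(\ell)e-V(k)e+\phi(V(k))e,\ k=0,1,\dots,K\Big\}.$$ Suppose that $P^M(K;0)e>0$ (entrywise), and fix $B\in(0,\infty)$ such that $B\,P^M(K;0)e\ge be$. Then $$\|{}_{(n)}\pi_n-\pi\|\le\frac{8\{c_{\phi,B}(1)\}^{-1}}{r_\phi(c_{\phi,B}(m-1))}(V(1)+B)+\frac{2mMbd}{\kappa V'(n)}\qquad\text{for all }m,n\in\mathbb{N}.$$ In addition, if $K=0$, then $$\|{}_{(n)}\pi_n-\pi\|\le\frac{8}{r_\phi(m-1)}V(1)+\frac{2mMbd}{\kappa V'(n)}\qquad\text{for all }m,n\in\mathbb{N}.$$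
   Context: Notation: $\mathbb{Z}_+=\{0,1,2,\dots\}$, $\mathbb{N}=\{1,2,\dots\}$, $d\in\mathbb{N}$, $\mathbb{D}=\{1,\dots,d\}$, $\mathbb{F}=\mathbb{Z}_+\times\mathbb{D}$. Matrices on $\mathbb{F}$ are partitioned into $d\times d$ blocks $Q(k;\ell)$, $k,\ell\in\mathbb{Z}_+$; $Q^M(k;\ell)$ is the $(k,\ell)$th block of $Q^M$. Inequalities are entrywise; $e$ is a column vector of ones. A stochastic matrix $Q$ is in $\mathsf{BM}_d$ (block monotone) if $\sum_{m=\ell}^\infty Q(k;m)\le\sum_{m=\ell}^\infty Q(k+1;m)$ for all $k,\ell\in\mathbb{Z}_+$. GI/G/1-type matrix: $\{A(k);k\in\mathbb{Z}\}$, $\{B(k);k\in\mathbb{Z}_+\}$ are nonnegative $d\times d$ matrices, $\underline A(-k)=\sum_{\ell=-\infty}^{-k}A(\ell)$ for $k\in\mathbb{Z}_+$, and $P$ has blocks $P(0;\ell)=B(\ell)$ ($\ell\ge0$), $P(k;0)=\underline A(-k)$ ($k\ge1$), $P(k;\ell)=A(\ell-k)$ ($k,\ell\ge1$). $\varpi$ is the stationary probability vector of $A$. Under the assumptions $P$ is positive recurrent; $\pi$ is its unique stationary probability vector. For $N\in\mathbb{N}$: $A_N(k)=O$ for $k\le-N-1$, $A_N(-N)=\underline A(-N)$, $A_N(k)=A(k)$ for $k\ge-N+1$; $\sigma_N=\varpi\sum_{k\in\mathbb{Z}}kA_N(k)e$. $P_N$ is the stochastic matrix with blocks $P_N(0;\ell)=B(\ell)$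 ($\ell\ge0$), $P_N(k;0)=\sum_{\ell\le-k}A_N(\ell)$ ($k\ge1$; this is $\underline A(-k)$ for $k\le N$ and $O$ for $k>N$), $P_N(k;\ell)=A_N(\ell-k)$ ($k,\ell\ge1$). Convolutions: $A_N^{*1}=A_N$, $A_N^{*M}(k)=\sum_{\ell\in\mathbb{Z}}A_N^{*(M-1)}(k-\ell)A_N(\ell)$ for $M\ge2$; thus $A_N^{*M}(k)=O$ for $k<-L$, $L=MN$. Moment assumption (MA) on $(V,\alpha)$: $\alpha\in[0,1)$; for every $\delta>0$, $$\lim_{k\to\infty}\frac1{V'(k)}\sum_{\ell=\lfloor\delta k^{1-\alpha}\rfloor+1}^\infty V(k+\ell)A_N^{*M}(\ell)e=0;$$ and $V:[0,\infty)\to[1,\infty)$ is an increasing, convex and log-concave function such that (i) $\lim_{x\to\infty}(\log V(x))/x=\log r_{A_+}$ with $r_{A_+}=\sup\{z\ge1:\sum_{\ell=0}^\infty z^\ell A(\ell)\text{ is finite}\}$; (ii) $V$ is twice differentiable on $(0,\infty)$; (iii) $V'(0):=\lim_{x\downarrow0}V'(x)>0$ and $\lim_{x\to\infty}V'(x)=\infty$; (iv) $V''(x)/V'(x)$ is nonincreasing for $x>0$; (v) $\limsup_{\delta\downarrow0}\lim_{x\to\infty}V'(x+\delta x^{1-\alpha})/V'(x)=1$. $H_\phi(x)=\int_1^x\frac{dy}{\phi(y)}$ for $x\ge1$, with inverse $H_\phi^{-1}:[0,\infty)\to[1,\infty)$; $r_\phi(x)=\phi(H_\phi^{-1}(x))$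 for $x\ge0$; $c_{\phi,B}(x)=\frac{\phi(1)}{\phi(B+1)}x$ for $x\ge0$. For $n\in\mathbb{N}$, the LC-block-augmented truncation ${}_{(n)}P_n$ of $P$ is the stochastic matrix on $\mathbb{F}$ with blocks ${}_{(n)}P_n(k;\ell)=P(k;\ell)$ for $\ell\le n-1$, $=\sum_{m=n}^\infty P(k;m)$ for $\ell=n$, $=O$ for $\ell>n$ (all $k\in\mathbb{Z}_+$); ${}_{(n)}\pi_n$ is a stationary probability vector of it (at least one exists). $\|\mu-\eta\|=\sum_{(k,i)\in\mathbb{F}}|\mu(k,i)-\eta(k,i)|$. *)

theory Defs
  imports "HOL-Analysis.Analysis"
begin

definition stochastic_mat :: "('a \<Rightarrow> 'a \<Rightarrow> real) \<Rightarrow> bool" where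
  "stochastic_mat Q \<longleftrightarrow> (\<forall>x y. 0 \<le> Q x y) \<and> (\<forall>x. (Q x has_sum 1) UNIV)"

primrec mat_pow :: "('a \<Rightarrow> 'a \<Rightarrow> real) \<Rightarrow> nat \<Rightarrow> 'a \<Rightarrow> 'a \<Rightarrow> real" where
  "mat_pow Q 0 = (\<lambda>x y. if x = y then 1 else 0)"
| "mat_pow Q (Suc n) = (\<lambda>x y. \<Sum>\<^sub>\<infinity>z. mat_pow Q n x z * Q z y)"

definition irreducible_mat :: "('a \<Rightarrow> 'a \<Rightarrow> real) \<Rightarrow> bool" where
  "irreducible_mat Q \<longleftrightarrow> (\<forall>x y. \<exists>n. 0 < mat_pow Q n x y)"

definition stationary_prob :: "('a \<Rightarrow> 'a \<Rightarrow> real) \<Rightarrow> ('a \<Rightarrow> real) \<Rightarrow> bool" where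
  "stationary_prob Q p \<longleftrightarrow>
     (\<forall>x. 0 \<le> p x) \<and> (p has_sum 1) UNIV \<and> (\<forall>y. ((\<lambda>x. p x * Q x y) has_sum p y) UNIV)"

definition l1_dist :: "('a \<Rightarrow> real) \<Rightarrow> ('a \<Rightarrow> real) \<Rightarrow> real" where
  "l1_dist p q = (\<Sum>\<^sub>\<infinity>x. \<bar>p x - q x\<bar>)"

text \<open>The set of phases \<open>{1,\<dots>,d}\<close> is an arbitrary finite type \<open>'d\<close>, so \<open>d = CARD('d)\<close>. A matrix on
  the state space \<open>nat \<times> 'd\<close> has blocks of type \<open>real^'d^'d\<close>; the row sums of a block \<open>X\<close> are
  \<open>X *v 1\<close>, where \<open>1\<close> is the all-ones vector. Strict inequalities between vectors are always
  written out entrywise, because \<open><\<close> on \<open>real^'d\<close> is not the entrywise order.\<close>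

type_synonym 'd bmat = "nat \<times> 'd \<Rightarrow> nat \<times> 'd \<Rightarrow> real"

definition of_blocks :: "(nat \<Rightarrow> nat \<Rightarrow> real^'d^'d) \<Rightarrow> 'd bmat" where
  "of_blocks F = (\<lambda>(k, i) (l, j). F k l $ i $ j)"

definition blk :: "'d bmat \<Rightarrow> nat \<Rightarrow> nat \<Rightarrow> real^'d^'d" where
  "blk Q k l = (\<chi> i j. Q (k, i) (l, j))"

definition block_monotone :: "'d::finite bmat \<Rightarrow> bool" where
  "block_monotone Q \<longleftrightarrow> stochastic_mat Q \<and>
     (\<forall>k l. (\<Sum>\<^sub>\<infinity>m\<in>{l..}. blk Q k m) \<le> (\<Sum>\<^sub>\<infinity>m\<in>{l..}. blk Q (k + 1) m))"

definition lc_trunc :: "nat \<Rightarrow> 'd::finite bmat \<Rightarrow> 'd bmat" where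
  "lc_trunc n Q = of_blocks (\<lambda>k l.
     if l < n then blk Q k l else if l = n then (\<Sum>\<^sub>\<infinity>m\<in>{n..}. blk Q k m) else 0)"

text \<open>\<open>lower_sum A k\<close> is \<open>\<Sum>_{l \<le> -k} A(l)\<close>.\<close>

definition lower_sum :: "(int \<Rightarrow> real^'d^'d) \<Rightarrow> nat \<Rightarrow> real^'d::finite^'d" where
  "lower_sum A k = (\<Sum>\<^sub>\<infinity>l\<in>{..- int k}. A l)"

definition GIG1 :: "(int \<Rightarrow> real^'d^'d) \<Rightarrow> (nat \<Rightarrow> real^'d^'d) \<Rightarrow> 'd::finite bmat" where
  "GIG1 A B = of_blocks (\<lambda>k l.
     if k = 0 then B l else if l = 0 then lower_sum A k else A (int l - int k))"

definition trunc_A :: "nat \<Rightarrow> (int \<Rightarrow> real^'d^'d) \<Rightarrow> int \<Rightarrow> real^'d::finite^'d" where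
  "trunc_A N A k =
     (if k \<le> - int N - 1 then 0 else if k = - int N then lower_sum A N else A k)"

primrec conv_pow :: "(int \<Rightarrow> real^'d^'d) \<Rightarrow> nat \<Rightarrow> int \<Rightarrow> real^'d::finite^'d" where
  "conv_pow A 0 = (\<lambda>k. if k = 0 then mat 1 else 0)"
| "conv_pow A (Suc M) = (\<lambda>k. \<Sum>\<^sub>\<infinity>l. conv_pow A M (k - l) ** A l)"

lemma conv_pow_1: "conv_pow A 1 = A"
proof
  fix k
  have "conv_pow A 1 k = (\<Sum>\<^sub>\<infinity>l. if l = k then A k else 0)"
    by (auto intro!: infsum_cong)
  also have "\<dots> = (\<Sum>\<^sub>\<infinity>l\<in>{k}. A k)"
    by (intro infsum_cong_neutral) auto
  finally show "conv_pow A 1 k = A k" by simp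
qed

text \<open>\<open>mean_drift w A\<close> is \<open>w (\<Sum>_k k A(k)) e\<close> for nonnegative \<open>A\<close>. It is extended-real valued,
  so that an infinite mean is not silently replaced by \<open>0\<close>: it is \<open>-\<infinity>\<close> if only the
  negative part diverges, and \<open>\<infinity>\<close> (because \<open>\<infinity> - \<infinity> = \<infinity>\<close> in \<open>ereal\<close>) as soon as the
  positive part of an entry with positive weight diverges.\<close>

definition row_mean :: "(int \<Rightarrow> real^'d^'d) \<Rightarrow> 'd::finite \<Rightarrow> ereal" where
  "row_mean A i =
     enn2ereal (\<Sum>\<^sub>\<infinity>k\<in>{0..}. ennreal (of_int k * (A k *v 1) $ i))
     - enn2ereal (\<Sum>\<^sub>\<infinity>k\<in>{..<0}. ennreal (of_int (- k) * (A k *v 1) $ i))"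

definition mean_drift :: "('d \<Rightarrow> real) \<Rightarrow> (int \<Rightarrow> real^'d::finite^'d) \<Rightarrow> ereal" where
  "mean_drift w A = (\<Sum>i\<in>UNIV. ereal (w i) * row_mean A i)"

text \<open>The \<open>i\<close>-th entry of \<open>(1/V'(k)) \<Sum>_{l > \<lfloor>\<delta> k^{1-\<alpha>}\<rfloor>} V(k+l) C(l) e\<close>; it is \<open>\<infinity>\<close> if the
  series diverges.\<close>

definition tail_moment ::
  "(real \<Rightarrow> real) \<Rightarrow> (real \<Rightarrow> real) \<Rightarrow> real \<Rightarrow> (int \<Rightarrow> real^'d^'d) \<Rightarrow> real \<Rightarrow> nat \<Rightarrow> 'd::finite \<Rightarrow> ennreal"
where
  "tail_moment V V' \<alpha> C \<delta> k i =
     (\<Sum>\<^sub>\<infinity>l\<in>{\<lfloor>\<delta> * real k powr (1 - \<alpha>)\<rfloor> + 1..}. ennreal (V (real k + of_int l) * (C l *v 1) $ i))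
     / ennreal (V' (real k))"

definition conv_radius_plus :: "(int \<Rightarrow> real^'d::finite^'d) \<Rightarrow> ereal" where
  "conv_radius_plus A =
     Sup {ereal z | z. 1 \<le> z \<and> (\<lambda>l::nat. z ^ l *\<^sub>R A (int l)) summable_on UNIV}"

definition ln_ereal :: "ereal \<Rightarrow> ereal" where
  "ln_ereal r = (if r = \<infinity> then \<infinity> else ereal (ln (real_of_ereal r)))"

text \<open>\<open>V'\<close> and \<open>V''\<close> are the first two derivatives of \<open>V\<close> on \<open>(0,\<infinity>)\<close>, and \<open>V' 0\<close> is the right
  limit of \<open>V'\<close> at \<open>0\<close>. The function \<open>C\<close> is the convolution power \<open>A_N^{*M}\<close>. In the last conjunct,
  \<open>g \<delta>\<close> is the inner limit of the iterated limit.\<close>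

definition moment_assumption ::
  "(real \<Rightarrow> real) \<Rightarrow> (real \<Rightarrow> real) \<Rightarrow> (real \<Rightarrow> real) \<Rightarrow> real \<Rightarrow>
   (int \<Rightarrow> real^'d::finite^'d) \<Rightarrow> (int \<Rightarrow> real^'d^'d) \<Rightarrow> bool"
where
  "moment_assumption V V' V'' \<alpha> A C \<longleftrightarrow>
     0 \<le> \<alpha> \<and> \<alpha> < 1 \<and>
     (\<forall>\<delta>>0. \<forall>i. (\<lambda>k. tail_moment V V' \<alpha> C \<delta> k i) \<longlonglongrightarrow> 0) \<and>
     (\<forall>x\<ge>0. 1 \<le> V x) \<and>
     strict_mono_on {0..} V \<and> convex_on {0..} V \<and> concave_on {0..} (\<lambda>x. ln (V x)) \<and>
     ((\<lambda>x. ereal (ln (V x) / x)) \<longlongrightarrow> ln_ereal (conv_radius_plus A)) at_top \<and>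
     (\<forall>x>0. (V has_real_derivative V' x) (at x) \<and> (V' has_real_derivative V'' x) (at x)) \<and>
     (V' \<longlongrightarrow> V' 0) (at_right 0) \<and> 0 < V' 0 \<and> filterlim V' at_top at_top \<and>
     (\<forall>x y. 0 < x \<and> x \<le> y \<longrightarrow> V'' y / V' y \<le> V'' x / V' x) \<and>
     (\<exists>g :: real \<Rightarrow> ereal.
        (\<forall>\<^sub>F \<delta> in at_right 0.
           ((\<lambda>x. ereal (V' (x + \<delta> * x powr (1 - \<alpha>)) / V' x)) \<longlongrightarrow> g \<delta>) at_top) \<and>
        Limsup (at_right 0) g = 1)"

text \<open>The inverse of \<open>V\<close> is meaningful on \<open>V ` {0..}\<close> only. For \<open>\<phi>\<close> to be defined on all of
  \<open>{1..}\<close>, as \<open>H_fun\<close> requires, \<open>V\<close> has to map \<open>{0..}\<close> onto \<open>{1..}\<close>.\<close>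

definition phi_of :: "real \<Rightarrow> (real \<Rightarrow> real) \<Rightarrow> (real \<Rightarrow> real) \<Rightarrow> real \<Rightarrow> real" where
  "phi_of \<kappa> V V' t = \<kappa> * V' (the_inv_into {0..} V t)"

definition H_fun :: "(real \<Rightarrow> real) \<Rightarrow> real \<Rightarrow> real" where
  "H_fun \<phi> x = integral {1..x} (\<lambda>y. 1 / \<phi> y)"

definition r_fun :: "(real \<Rightarrow> real) \<Rightarrow> real \<Rightarrow> real" where
  "r_fun \<phi> x = \<phi> (the_inv_into {1..} (H_fun \<phi>) x)"

definition c_fun :: "(real \<Rightarrow> real) \<Rightarrow> real \<Rightarrow> real \<Rightarrow> real" where
  "c_fun \<phi> B x = \<phi> 1 / \<phi> (B + 1) * x"

text \<open>The constant \<open>b\<close>, for \<open>Q = P_N^M\<close>. It is \<open>\<infinity>\<close> if one of the series diverges.\<close>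

definition drift_const :: "(real \<Rightarrow> real) \<Rightarrow> (real \<Rightarrow> real) \<Rightarrow> 'd::finite bmat \<Rightarrow> nat \<Rightarrow> ereal" where
  "drift_const \<phi> V Q K = Inf {x. 0 \<le> x \<and>
     (\<forall>k\<le>K. \<forall>i. enn2ereal (\<Sum>\<^sub>\<infinity>l. ennreal (V (real l) * (blk Q k l *v 1) $ i))
                  - ereal (V (real k)) + ereal (\<phi> (V (real k))) \<le> x)}"

end

theory Submission
  imports Defs "HOL-Probability.Probability_Mass_Function"
begin

text \<open>Two chains with a block-monotone kernel, ordered levels and common phases can be coupled so that they
  merge as soon as the upper one reaches level \<open>0\<close>. Hence the chain started at level \<open>0\<close> with the
  stationary phase distribution is, after \<open>m\<close> steps of the \<open>M\<close>-skeleton, as close to stationarity as the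
  probability that the stationary skeleton avoids level \<open>0\<close> for \<open>m\<close> steps. Since
  \<open>H\<^sub>\<phi> (V x) = x / \<kappa>\<close>, the rate is \<open>r\<^sub>\<phi> t = \<kappa> V' (\<kappa> t)\<close>, and the drift
  condition turns \<open>V (x + \<kappa> n) - V (\<kappa> n)\<close>, evaluated along the skeleton, into a supermartingale which
  bounds that probability. This applies to the chain and to its truncation, as the latter is dominated by the
  former. The two chains started at level \<open>0\<close> differ after \<open>m M\<close> steps by at most \<open>m M\<close> times the
  truncated stationary mass at level \<open>n\<close>, which is at most \<open>b / (\<kappa> V' n)\<close> by the drift condition.\<close>

section \<open>Sums over countable sets\<close>

text \<open>The drift inequality is not checked on \<open>P\<close> directly: its downward jumps may
  be unbounded, so that the boundary can be felt within \<open>M\<close> steps from every level.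
  Cutting them at \<open>N\<close> lifts target levels, hence \<open>P\<^sub>N\<close> dominates
  \<open>P\<close> in the level order, and above level \<open>M * N\<close> its
  \<open>M\<close>-step law is the convolution power. There the moment assumption gives the drift
  \<open>- \<kappa> V'\<close>; as \<open>V\<close> is increasing, domination carries it back to
  \<open>P\<close>. On levels up to \<open>K\<close> the drift has a defect \<open>b\<close>. It is
  absorbed by adding \<open>\<beta>\<close> to \<open>V\<close> off level \<open>0\<close>: from
  these levels the skeleton is at level \<open>0\<close> after one step with probability at least
  \<open>b / \<beta>\<close>, so the expected added term drops by at least \<open>b\<close>. Writing
  the new function as \<open>V (u l)\<close> lets one supermartingale argument serve both bounds;
  the price is a comparison of \<open>\<phi> (V l)\<close> with
  \<open>\<phi> (V l + \<beta>)\<close>, the origin of \<open>c_fun\<close>. The two approaches to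
  stationarity each enter the l1 distance twice, which gives the factor 4 and time \<open>m\<close>;
  the stated 8, \<open>m - 1\<close> and the factor \<open>d\<close> follow by monotonicity.\<close>

lemma nn_integral_count_space_has_sum:
  fixes f :: "'a \<Rightarrow> real"
  assumes "(f has_sum s) A" and "\<And>x. x \<in> A \<Longrightarrow> 0 \<le> f x"
  shows "(\<integral>\<^sup>+x. ennreal (f x) \<partial>count_space A) = ennreal s"
proof -
  have "f summable_on A" using assms(1) by (auto simp: summable_on_def)
  then have "Infinite_Sum.abs_summable_on f A"
    by (rule summable_on_iff_abs_summable_on_real[THEN iffD1])
  then have ab: "Infinite_Set_Sum.abs_summable_on f A"
    by (rule abs_summable_equivalent[THEN iffD1])
  have "infsetsum f A = s"
    using ab assms(1) by (simp add: infsetsum_infsum infsumI)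
  then show ?thesis
    using nn_integral_conv_infsetsum[OF ab assms(2)] by simp
qed

lemma has_sum_nn_integral_count_space:
  fixes f :: "'a \<Rightarrow> real"
  assumes "(\<integral>\<^sup>+x. ennreal (f x) \<partial>count_space A) = ennreal s"
    and "\<And>x. x \<in> A \<Longrightarrow> 0 \<le> f x" and "0 \<le> s"
  shows "(f has_sum s) A"
proof -
  have "Infinite_Set_Sum.abs_summable_on f A"
    unfolding Infinite_Set_Sum.abs_summable_on_def
  proof (rule integrableI_nonneg)
    show "AE x in count_space A. 0 \<le> f x" using assms(2) by (simp add: AE_count_space)
    show "(\<integral>\<^sup>+x. ennreal (f x) \<partial>count_space A) < \<infinity>" unfolding assms(1) by simp
  qed simp
  then have "Infinite_Sum.abs_summable_on f A" by (rule abs_summable_equivalent[THEN iffD2])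
  then have "f summable_on A" by (rule summable_on_iff_abs_summable_on_real[THEN iffD2])
  then obtain t where t: "(f has_sum t) A" by (auto simp: summable_on_def)
  then have "0 \<le> t" using assms(2) by (rule has_sum_nonneg)
  then have "s = t"
    using nn_integral_count_space_has_sum[OF t assms(2)] assms by simp
  with t show ?thesis by simp
qed

text \<open>Divergence needs no exception: a non-summable \<open>infsum\<close> is \<open>0\<close>,
  and so is \<open>enn2real\<close> of an infinite integral.\<close>

lemma infsum_eq_enn2real_nn_integral:
  fixes f :: "'a \<Rightarrow> real"
  assumes "\<And>x. x \<in> A \<Longrightarrow> 0 \<le> f x"
  shows "infsum f A = enn2real (\<integral>\<^sup>+x. ennreal (f x) \<partial>count_space A)"
proof (cases "\<integral>\<^sup>+x. ennreal (f x) \<partial>count_space A" rule: ennreal_cases)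
  case (real r)
  then show ?thesis
    using has_sum_nn_integral_count_space[where f = f and A = A and s = r] assms by (auto dest: infsumI)
next
  case top
  have "\<not> f summable_on A"
  proof
    assume "f summable_on A"
    then obtain t where t: "(f has_sum t) A" by (auto simp: summable_on_def)
    from nn_integral_count_space_has_sum[OF this assms] top show False by simp
  qed
  then show ?thesis using top by (simp add: infsum_not_exists)
qed

text \<open>Countability serves the bound of the integral by the sum: numbering the elements by
  \<open>to_nat\<close> turns the integral into a series whose partial sums are finite sums over
  subsets of \<open>A\<close>.\<close>

lemma infsum_ennreal_eq_nn_integral_count_space:
  fixes f :: "'a::countable \<Rightarrow> ennreal"
  shows "infsum f A = (\<integral>\<^sup>+x. f x \<partial>count_space A)"
proof (rule antisym)
  have cs: "(\<integral>\<^sup>+x. h x \<partial>count_space S) = (\<integral>\<^sup>+x. h x * indicator S x \<partial>count_space UNIV)"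
    for S and h :: "'a \<Rightarrow> ennreal"
    by (rule nn_integral_count_space_indicator) simp
  have "infsum f A = (SUP F\<in>{F. finite F \<and> F \<subseteq> A}. sum f F)"
    by (rule nonneg_infsum_complete) auto
  also have "\<dots> \<le> (\<integral>\<^sup>+x. f x \<partial>count_space A)"
  proof (rule SUP_least)
    fix F assume "F \<in> {F. finite F \<and> F \<subseteq> A}"
    then have F: "finite F" "F \<subseteq> A" by auto
    have "sum f F = (\<integral>\<^sup>+x. f x \<partial>count_space F)"
      using F by (simp add: nn_integral_count_space_finite)
    also have "\<dots> \<le> (\<integral>\<^sup>+x. f x \<partial>count_space A)"
      unfolding cs[of F f] cs[of A f] using F by (intro nn_integral_mono) (auto split: split_indicator)
    finally show "sum f F \<le> (\<integral>\<^sup>+x. f x \<partial>count_space A)" .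
  qed
  finally show "infsum f A \<le> (\<integral>\<^sup>+x. f x \<partial>count_space A)" .
next
  define g where "g n = (if n \<in> to_nat ` A then f (from_nat n) else 0)" for n
  have b: "bij_betw to_nat A (to_nat ` A)" by (auto simp: bij_betw_def inj_on_def)
  have "(\<integral>\<^sup>+x. f x \<partial>count_space A) = (\<integral>\<^sup>+x. g (to_nat x) \<partial>count_space A)"
    by (intro nn_integral_cong) (auto simp: g_def)
  also have "\<dots> = (\<integral>\<^sup>+n. g n \<partial>count_space (to_nat ` A))"
    using b by (rule nn_integral_bij_count_space)
  also have "\<dots> = (\<integral>\<^sup>+n. g n \<partial>count_space UNIV)"
    by (rule nn_integral_count_space_eq) (auto simp: g_def)
  also have "\<dots> = (\<Sum>n. g n)" by (rule nn_integral_count_space_nat)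
  also have "\<dots> \<le> infsum f A"
  proof (rule suminf_le_const)
    fix n
    have "sum g {..<n} = sum g ({..<n} \<inter> to_nat ` A)"
      by (intro sum.mono_neutral_right) (auto simp: g_def)
    also have "\<dots> = sum f {x \<in> A. to_nat x < n}"
      by (rule sum.reindex_cong[of to_nat]) (auto simp: g_def inj_on_def)
    also have "\<dots> \<le> infsum f A"
    proof -
      have "finite {x \<in> A. to_nat x < n}"
        by (rule finite_imageD[of to_nat], rule finite_subset[of _ "{..<n}"]) (auto simp: inj_on_def)
      then show ?thesis
        by (subst nonneg_infsum_complete) (auto intro!: SUP_upper)
    qed
    finally show "sum g {..<n} \<le> infsum f A" .
  qed simp
  finally show "(\<integral>\<^sup>+x. f x \<partial>count_space A) \<le> infsum f A" .
qed

lemma has_sum_vec_iff: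
  fixes f :: "'a \<Rightarrow> 'b::real_normed_vector ^ 'n::finite"
  shows "(f has_sum s) A \<longleftrightarrow> (\<forall>i. ((\<lambda>x. f x $ i) has_sum s $ i) A)"
proof
  assume "(f has_sum s) A"
  then show "\<forall>i. ((\<lambda>x. f x $ i) has_sum s $ i) A"
    unfolding has_sum_def by (auto dest: tendsto_vec_nth simp: sum_component)
next
  assume "\<forall>i. ((\<lambda>x. f x $ i) has_sum s $ i) A"
  then show "(f has_sum s) A"
    unfolding has_sum_def by (intro vec_tendstoI) (simp add: sum_component)
qed

text \<open>Summability of all entries is asked for because one divergent entry makes the whole
  matrix \<open>infsum\<close> the default \<open>0\<close>.\<close>

lemma infsum_matrix_nth:
  fixes f :: "'a \<Rightarrow> real ^ 'n::finite ^ 'm::finite"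
  assumes "\<And>i j. (\<lambda>x. f x $ i $ j) summable_on A"
  shows "f summable_on A" and "infsum f A $ i $ j = (\<Sum>\<^sub>\<infinity>x\<in>A. f x $ i $ j)"
proof -
  define s where "s = (\<chi> i j. \<Sum>\<^sub>\<infinity>x\<in>A. f x $ i $ j)"
  have "(f has_sum s) A"
    using assms by (simp add: has_sum_vec_iff s_def)
  then show "f summable_on A" "infsum f A $ i $ j = (\<Sum>\<^sub>\<infinity>x\<in>A. f x $ i $ j)"
    by (auto simp: summable_on_def infsumI s_def)
qed

section \<open>Markov kernels\<close>

text \<open>With kernels valued in \<open>pmf\<close>, composition is \<open>bind_pmf\<close>:
  associativity comes for free, and expectations are nonnegative integrals without integrability
  conditions.\<close>

primrec kernel_pow :: "('s \<Rightarrow> 's pmf) \<Rightarrow> nat \<Rightarrow> 's \<Rightarrow> 's pmf" where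
  "kernel_pow k 0 = return_pmf"
| "kernel_pow k (Suc n) = (\<lambda>x. bind_pmf (kernel_pow k n x) k)"

lemma kernel_pow_add: "kernel_pow k (m + n) x = bind_pmf (kernel_pow k m x) (kernel_pow k n)"
  by (induction n) (auto simp: bind_return_pmf' bind_assoc_pmf)

lemma kernel_pow_Suc_left: "kernel_pow k (Suc n) x = bind_pmf (k x) (kernel_pow k n)"
  using kernel_pow_add[of k 1 n x] by (simp add: bind_return_pmf)

lemma kernel_pow_mult: "kernel_pow (kernel_pow k m) n = kernel_pow k (m * n)"
proof (induction n)
  case (Suc n)
  have "m * Suc n = m * n + m" by simp
  then show ?case by (simp only: kernel_pow.simps Suc kernel_pow_add)
qed simp

lemma bind_kernel_pow_stationary:
  assumes "bind_pmf p k = p"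
  shows "bind_pmf p (kernel_pow k n) = p"
proof (induction n)
  case (Suc n)
  have "bind_pmf p (kernel_pow k (Suc n)) = bind_pmf (bind_pmf p (kernel_pow k n)) k"
    by (simp only: bind_assoc_pmf kernel_pow.simps)
  then show ?case by (simp only: Suc assms)
qed (simp add: bind_return_pmf')

lemma stochastic_mat_kernel:
  assumes "stochastic_mat Q"
  obtains k where "\<And>x y. pmf (k x) y = Q x y"
proof -
  have "(\<integral>\<^sup>+y. ennreal (Q x y) \<partial>count_space UNIV) = 1" for x
    using assms nn_integral_count_space_has_sum[where f = "Q x" and s = 1 and A = UNIV] by (simp add: stochastic_mat_def)
  then have "pmf (embed_pmf (Q x)) y = Q x y" for x y
    using assms by (intro pmf_embed_pmf) (auto simp: stochastic_mat_def)
  then show thesis by (intro that[of "\<lambda>x. embed_pmf (Q x)"]) blast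
qed

lemma mat_pow_eq_pmf:
  assumes "\<And>x y. pmf (k x) y = Q x y"
  shows "mat_pow Q n x y = pmf (kernel_pow k n x) y"
proof (induction n arbitrary: x y)
  case (Suc n)
  have "ennreal (pmf (bind_pmf (kernel_pow k n x) k) y)
      = (\<integral>\<^sup>+z. ennreal (mat_pow Q n x z * Q z y) \<partial>count_space UNIV)"
    unfolding ennreal_pmf_bind nn_integral_measure_pmf
    by (simp add: Suc assms[symmetric] ennreal_mult)
  moreover have "mat_pow Q (Suc n) x y
      = enn2real (\<integral>\<^sup>+z. ennreal (mat_pow Q n x z * Q z y) \<partial>count_space UNIV)"
    unfolding mat_pow.simps by (rule infsum_eq_enn2real_nn_integral) (simp add: Suc assms[symmetric])
  ultimately show ?case
    by (metis enn2real_ennreal kernel_pow.simps(2) pmf_nonneg)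
qed (auto simp: indicator_def)

lemma stationary_prob_pmf:
  assumes Q: "\<And>x y. pmf (k x) y = Q x y" and p: "stationary_prob Q p"
  obtains q where "\<And>x. pmf q x = p x" and "bind_pmf q k = q"
proof -
  have 1: "(\<integral>\<^sup>+y. ennreal (p y) \<partial>count_space UNIV) = 1"
    using p nn_integral_count_space_has_sum[where f = p and s = 1 and A = UNIV] by (simp add: stationary_prob_def)
  have q: "pmf (embed_pmf p) x = p x" for x
    using p 1 by (intro pmf_embed_pmf) (auto simp: stationary_prob_def)
  have "bind_pmf (embed_pmf p) k = embed_pmf p"
  proof (rule pmf_eqI)
    fix y
    have "ennreal (pmf (bind_pmf (embed_pmf p) k) y) = (\<integral>\<^sup>+x. ennreal (p x * Q x y) \<partial>count_space UNIV)"
      unfolding ennreal_pmf_bind nn_integral_measure_pmf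
      using p by (simp add: q Q[symmetric] ennreal_mult stationary_prob_def)
    also have "\<dots> = ennreal (p y)"
      using p by (intro nn_integral_count_space_has_sum) (auto simp: stationary_prob_def Q[symmetric])
    finally show "pmf (bind_pmf (embed_pmf p) k) y = pmf (embed_pmf p) y"
      using p by (simp add: q stationary_prob_def)
  qed
  with q that show thesis by blast
qed

section \<open>The l1 distance of two laws\<close>

lemma has_sum_pmf:
  "(pmf p has_sum measure_pmf.prob p S) S"
  by (rule has_sum_nn_integral_count_space)
     (auto simp: nn_integral_pmf measure_pmf.emeasure_eq_measure)

text \<open>The supremum of \<open>p S - q S\<close> over sets \<open>S\<close> is half of the \<open>l\<^sub>1\<close> distance.\<close>

lemma l1_dist_le_of_measure_le:
  assumes pq: "\<And>S. measure_pmf.prob p S \<le> measure_pmf.prob q S + e"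
  shows "l1_dist (pmf p) (pmf q) \<le> 2 * e"
proof -
  define S where "S = {x. pmf q x < pmf p x}"
  have d: "((\<lambda>x. pmf r x - pmf t x) has_sum (measure_pmf.prob r T - measure_pmf.prob t T)) T"
    for r t :: "'a pmf" and T
    using has_sum_add[OF has_sum_pmf[of r T] has_sum_uminusI[OF has_sum_pmf[of t T]]] by simp
  have "((\<lambda>x. \<bar>pmf p x - pmf q x\<bar>) has_sum (measure_pmf.prob p S - measure_pmf.prob q S)) S"
    by (rule has_sum_cong[THEN iffD1, OF _ d[of p q S]]) (simp add: S_def)
  moreover have "((\<lambda>x. \<bar>pmf p x - pmf q x\<bar>) has_sum (measure_pmf.prob q (- S) - measure_pmf.prob p (- S))) (- S)"
    by (rule has_sum_cong[THEN iffD1, OF _ d[of q p "- S"]]) (simp add: S_def)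
  ultimately have "((\<lambda>x. \<bar>pmf p x - pmf q x\<bar>) has_sum
      ((measure_pmf.prob p S - measure_pmf.prob q S) + (measure_pmf.prob q (- S) - measure_pmf.prob p (- S)))) (S \<union> - S)"
    by (rule has_sum_Un_disjoint) auto
  moreover have "measure_pmf.prob r (- S) = 1 - measure_pmf.prob r S" for r
    using measure_pmf.prob_compl[of S r] by (simp add: Compl_eq_Diff_UNIV)
  ultimately have "l1_dist (pmf p) (pmf q) = 2 * (measure_pmf.prob p S - measure_pmf.prob q S)"
    by (simp add: l1_dist_def infsumI)
  then show ?thesis using pq[of S] by simp
qed

text \<open>A one-sided bound over all sets is two-sided: complements reverse the
  inequality.\<close>

lemma measure_le_compl:
  assumes "\<And>S. measure_pmf.prob p S \<le> measure_pmf.prob q S + e"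
  shows "measure_pmf.prob q S \<le> measure_pmf.prob p S + e"
  using assms[of "- S"] measure_pmf.prob_compl[of S p] measure_pmf.prob_compl[of S q]
  by (simp add: Compl_eq_Diff_UNIV)

lemma measure_le_of_nn_integral_le:
  assumes "(\<integral>\<^sup>+x. indicator S x \<partial>measure_pmf p) \<le> (\<integral>\<^sup>+x. indicator S x \<partial>measure_pmf q) + ennreal e" and "0 \<le> e"
  shows "measure_pmf.prob p S \<le> measure_pmf.prob q S + e"
  using assms by (simp add: measure_pmf.emeasure_eq_measure ennreal_plus[symmetric] del: ennreal_plus)

section \<open>Monotone kernels\<close>

text \<open>Levels are compared within one phase only; for this order, block monotonicity is
  stochastic monotonicity. The indicator of a set of phases is level-increasing together with that
  of its complement.\<close>

definition level_mono :: "(nat \<times> 'd \<Rightarrow> ennreal) \<Rightarrow> bool" where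
  "level_mono g \<longleftrightarrow> (\<forall>j k l. k \<le> l \<longrightarrow> g (k, j) \<le> g (l, j))"

definition monotone_kernel :: "(nat \<times> 'd \<Rightarrow> (nat \<times> 'd) pmf) \<Rightarrow> bool" where
  "monotone_kernel K \<longleftrightarrow> (\<forall>g. level_mono g \<longrightarrow> level_mono (\<lambda>x. \<integral>\<^sup>+y. g y \<partial>K x))"

definition dominated_kernel ::
    "(nat \<times> 'd \<Rightarrow> (nat \<times> 'd) pmf) \<Rightarrow> (nat \<times> 'd \<Rightarrow> (nat \<times> 'd) pmf) \<Rightarrow> bool" where
  "dominated_kernel K K' \<longleftrightarrow>
     (\<forall>g x. level_mono g \<longrightarrow> (\<integral>\<^sup>+y. g y \<partial>K x) \<le> (\<integral>\<^sup>+y. g y \<partial>K' x))"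

lemma level_monoD: "level_mono g \<Longrightarrow> k \<le> l \<Longrightarrow> g (k, j) \<le> g (l, j)"
  by (auto simp: level_mono_def)

lemma monotone_kernelD: "monotone_kernel K \<Longrightarrow> level_mono g \<Longrightarrow> level_mono (\<lambda>x. \<integral>\<^sup>+y. g y \<partial>K x)"
  by (auto simp: monotone_kernel_def)

lemma dominated_kernelD:
  "dominated_kernel K K' \<Longrightarrow> level_mono g \<Longrightarrow> (\<integral>\<^sup>+y. g y \<partial>K x) \<le> (\<integral>\<^sup>+y. g y \<partial>K' x)"
  unfolding dominated_kernel_def by blast

lemma monotone_kernel_pow:
  assumes "monotone_kernel K"
  shows "monotone_kernel (kernel_pow K n)"
proof (induction n)
  case 0
  then show ?case by (auto simp: monotone_kernel_def)
next
  case (Suc n)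
  show ?case
    unfolding monotone_kernel_def
  proof (intro allI impI)
    fix g :: "nat \<times> 'a \<Rightarrow> ennreal" assume "level_mono g"
    from monotone_kernelD[OF Suc monotone_kernelD[OF assms this]]
    show "level_mono (\<lambda>x. \<integral>\<^sup>+y. g y \<partial>kernel_pow K (Suc n) x)" by simp
  qed
qed

text \<open>The last step is replaced pointwise; the other \<open>n\<close> steps then act on a
  function that is level-increasing because the upper kernel is monotone. This version compares the
  truncated chain with the original one.\<close>

lemma dominated_kernel_pow:
  assumes mono: "monotone_kernel K'" and dom: "dominated_kernel K K'"
  shows "dominated_kernel (kernel_pow K n) (kernel_pow K' n)"
proof (induction n)
  case 0
  then show ?case by (auto simp: dominated_kernel_def)
next
  case (Suc n)
  show ?case
    unfolding dominated_kernel_def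
  proof (intro allI impI)
    fix g :: "nat \<times> 'a \<Rightarrow> ennreal" and x assume g: "level_mono g"
    have "(\<integral>\<^sup>+y. g y \<partial>kernel_pow K (Suc n) x) = (\<integral>\<^sup>+z. \<integral>\<^sup>+y. g y \<partial>K z \<partial>kernel_pow K n x)" by simp
    also have "\<dots> \<le> (\<integral>\<^sup>+z. \<integral>\<^sup>+y. g y \<partial>K' z \<partial>kernel_pow K n x)"
      by (intro nn_integral_mono dominated_kernelD[OF dom g])
    also have "\<dots> \<le> (\<integral>\<^sup>+z. \<integral>\<^sup>+y. g y \<partial>K' z \<partial>kernel_pow K' n x)"
      by (intro dominated_kernelD[OF Suc] monotone_kernelD[OF mono g])
    finally show "(\<integral>\<^sup>+y. g y \<partial>kernel_pow K (Suc n) x) \<le> (\<integral>\<^sup>+y. g y \<partial>kernel_pow K' (Suc n) x)" by simp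
  qed
qed

text \<open>Now the lower kernel is the monotone one, so the two replacements are made in the
  opposite order. This is the version for \<open>P\<close> below \<open>P\<^sub>N\<close>, where
  monotonicity is at hand for \<open>P\<close>.\<close>

lemma dominated_kernel_pow':
  assumes mono: "monotone_kernel K" and dom: "dominated_kernel K K'"
  shows "dominated_kernel (kernel_pow K n) (kernel_pow K' n)"
proof (induction n)
  case 0
  then show ?case by (auto simp: dominated_kernel_def)
next
  case (Suc n)
  show ?case
    unfolding dominated_kernel_def
  proof (intro allI impI)
    fix g :: "nat \<times> 'a \<Rightarrow> ennreal" and x assume g: "level_mono g"
    have "(\<integral>\<^sup>+y. g y \<partial>kernel_pow K (Suc n) x) = (\<integral>\<^sup>+z. \<integral>\<^sup>+y. g y \<partial>K z \<partial>kernel_pow K n x)" by simp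
    also have "\<dots> \<le> (\<integral>\<^sup>+z. \<integral>\<^sup>+y. g y \<partial>K z \<partial>kernel_pow K' n x)"
      by (intro dominated_kernelD[OF Suc] monotone_kernelD[OF mono g])
    also have "\<dots> \<le> (\<integral>\<^sup>+z. \<integral>\<^sup>+y. g y \<partial>K' z \<partial>kernel_pow K' n x)"
      by (intro nn_integral_mono dominated_kernelD[OF dom g])
    finally show "(\<integral>\<^sup>+y. g y \<partial>kernel_pow K (Suc n) x) \<le> (\<integral>\<^sup>+y. g y \<partial>kernel_pow K' (Suc n) x)" by simp
  qed
qed

text \<open>The probability that the chain started in \<open>x\<close> avoids level \<open>0\<close> at the times \<open>0, \<dots>, n\<close>.\<close>

primrec survival :: "(nat \<times> 'd \<Rightarrow> (nat \<times> 'd) pmf) \<Rightarrow> nat \<Rightarrow> nat \<times> 'd \<Rightarrow> ennreal" where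
  "survival K 0 = (\<lambda>x. if fst x = 0 then 0 else 1)"
| "survival K (Suc n) = (\<lambda>x. if fst x = 0 then 0 else \<integral>\<^sup>+y. survival K n y \<partial>K x)"

lemma survival_level_0: "fst x = 0 \<Longrightarrow> survival K n x = 0"
  by (cases n) auto

lemma survival_le_1: "survival K n x \<le> 1"
proof (induction n arbitrary: x)
  case (Suc n)
  have "(\<integral>\<^sup>+y. survival K n y \<partial>K x) \<le> (\<integral>\<^sup>+y. 1 \<partial>K x)"
    by (intro nn_integral_mono Suc)
  then show ?case by simp
qed simp

lemma level_mono_survival:
  assumes "monotone_kernel K"
  shows "level_mono (survival K n)"
proof (induction n)
  case (Suc n)
  from monotone_kernelD[OF assms Suc] show ?case
    by (auto simp: level_mono_def)
qed (auto simp: level_mono_def)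

text \<open>This plays the role of a coupling of two chains with ordered levels and common phases that merge
  once the upper one has reached level \<open>0\<close>: the running maximum of \<open>g\<close> over the lower levels is
  level-increasing and exceeds \<open>g\<close> by at most the survival probability.\<close>

lemma kernel_pow_le_survival:
  assumes mono: "monotone_kernel K" and f: "\<And>x. f x \<le> 1"
  shows "j \<le> k \<Longrightarrow> (\<integral>\<^sup>+y. f y \<partial>kernel_pow K m (j, i)) \<le> (\<integral>\<^sup>+y. f y \<partial>kernel_pow K m (k, i)) + survival K m (k, i)"
proof (induction m arbitrary: j k i)
  case 0
  show ?case
  proof (cases "k = 0")
    case False
    have "f (j, i) \<le> 1" by (rule f)
    also have "\<dots> \<le> f (k, i) + 1" by simp
    finally show ?thesis using False by simp
  qed (use 0 in simp)
next
  case (Suc m)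
  show ?case
  proof (cases "k = 0")
    case False
    define g where "g y = (\<integral>\<^sup>+z. f z \<partial>kernel_pow K m y)" for y
    define h where "h y = (SUP a\<in>{..fst y}. g (a, snd y))" for y
    have h_mono: "level_mono h"
      unfolding level_mono_def h_def by (auto intro!: SUP_subset_mono)
    have gh: "g y \<le> h y" for y
      unfolding h_def by (rule SUP_upper2[of "fst y"]) auto
    \<comment> \<open>The induction hypothesis holds for every lower level with the same upper
      level, hence for the supremum; therefore \<open>j\<close> and \<open>k\<close> vary in the
      induction.\<close>
    have hg: "h y \<le> g y + survival K m y" for y
      unfolding h_def g_def using Suc.IH[of _ "fst y" "snd y"] by (intro SUP_least) auto
    have "(\<integral>\<^sup>+y. g y \<partial>K (j, i)) \<le> (\<integral>\<^sup>+y. h y \<partial>K (j, i))"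
      by (intro nn_integral_mono gh)
    also have "\<dots> \<le> (\<integral>\<^sup>+y. h y \<partial>K (k, i))"
      using level_monoD[OF monotone_kernelD[OF mono h_mono] Suc.prems] .
    also have "\<dots> \<le> (\<integral>\<^sup>+y. g y + survival K m y \<partial>K (k, i))"
      by (intro nn_integral_mono hg)
    also have "\<dots> = (\<integral>\<^sup>+y. g y \<partial>K (k, i)) + (\<integral>\<^sup>+y. survival K m y \<partial>K (k, i))"
      by (rule nn_integral_add) auto
    finally show ?thesis
      using False by (simp add: kernel_pow_Suc_left g_def del: kernel_pow.simps)
  qed (use Suc.prems in simp)
qed

text \<open>An inequality of Dynkin type with time-dependent weights: off level \<open>0\<close>,
  the potential \<open>F n\<close> pays \<open>R n\<close> now and the expected
  \<open>F (Suc n)\<close> for the future. Iteration bounds the total paid until level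
  \<open>0\<close> is reached.\<close>

lemma sum_survival_le:
  fixes K :: "nat \<times> 'd \<Rightarrow> (nat \<times> 'd) pmf" and F :: "nat \<Rightarrow> nat \<times> 'd \<Rightarrow> ennreal"
  assumes drift: "\<And>n x. fst x \<noteq> 0 \<Longrightarrow> (\<integral>\<^sup>+y. F (Suc n) y \<partial>K x) + R n \<le> F n x"
  shows "(\<Sum>j<J. R (n + j) * survival K j x) \<le> F n x"
proof (induction J arbitrary: n x)
  case (Suc J)
  show ?case
  proof (cases "fst x = 0")
    case False
    have "(\<Sum>j<Suc J. R (n + j) * survival K j x)
        = R n + (\<Sum>j<J. R (Suc n + j) * (\<integral>\<^sup>+y. survival K j y \<partial>K x))"
      using False by (subst sum.lessThan_Suc_shift) simp
    also have "\<dots> = R n + (\<integral>\<^sup>+y. (\<Sum>j<J. R (Suc n + j) * survival K j y) \<partial>K x)"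
      by (subst nn_integral_sum) (auto simp: nn_integral_cmult)
    also have "\<dots> \<le> R n + (\<integral>\<^sup>+y. F (Suc n) y \<partial>K x)"
      by (intro add_left_mono nn_integral_mono Suc.IH)
    also have "\<dots> \<le> F n x"
      using drift[OF False, of n] by (simp add: add.commute)
    finally show ?thesis .
  qed (simp add: survival_level_0)
qed simp

text \<open>Weights bounded below by \<open>R 0\<close> make the survival probabilities summable.
  The bound appears as \<open>max 0 w\<close> because \<open>ennreal w\<close> is \<open>0\<close>
  for negative \<open>w\<close>.\<close>

lemma survival_tendsto_0:
  assumes R0: "0 < R 0" and R_mono: "\<And>i. R 0 \<le> R i"
    and sums: "\<And>J. (\<Sum>j<J. ennreal (R j) * survival K j x) \<le> ennreal w"
  shows "(\<lambda>j. survival K j x) \<longlonglongrightarrow> 0"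
proof -
  define s where "s j = enn2real (survival K j x)" for j
  have surv: "survival K j x = ennreal (s j)" for j
    using survival_le_1[of K j x] unfolding s_def by (auto simp: ennreal_enn2real_if top_unique)
  have s0: "0 \<le> s j" for j by (simp add: s_def)
  have "sum s {..<J} \<le> max 0 w / R 0" for J
  proof -
    have "ennreal (\<Sum>j<J. R j * s j) \<le> ennreal w"
      using sums[of J] R0 R_mono s0
      by (subst sum_ennreal[symmetric]) (auto simp: surv ennreal_mult' order_trans[of 0 "R 0"] intro!: mult_nonneg_nonneg)
    then have "(\<Sum>j<J. R j * s j) \<le> max 0 w"
      by (metis ennreal_le_iff ennreal_max_0 max.cobounded1)
    moreover have "R 0 * sum s {..<J} \<le> (\<Sum>j<J. R j * s j)"
      unfolding sum_distrib_left by (intro sum_mono mult_right_mono R_mono s0)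
    ultimately show ?thesis using R0 by (simp add: field_simps)
  qed
  then have "summable s" using s0 by (intro summableI_nonneg_bounded)
  then have "s \<longlonglongrightarrow> 0" by (rule summable_LIMSEQ_zero)
  then show ?thesis unfolding surv using tendsto_ennrealI[of s 0] by simp
qed

text \<open>Decomposing the stationary excursion away from level \<open>0\<close> according to its starting time expresses
  the survival probability by those after a return to level \<open>0\<close>; by monotonicity the chain leaving
  level \<open>0\<close> survives less likely than the one leaving level \<open>1\<close>.\<close>

lemma stationary_survival_le:
  assumes mono: "monotone_kernel K" and stat: "bind_pmf p K = p"
    and R0: "0 < R 0" and R_mono: "incseq R"
    and sums: "\<And>J x. (\<Sum>j<J. ennreal (R j) * survival K j x) \<le> ennreal (w (fst x))"
  shows "ennreal (R m) * (\<integral>\<^sup>+x. survival K m x \<partial>p) \<le> ennreal (w 1)"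
proof -
  define a where "a n = (\<integral>\<^sup>+x. survival K n x \<partial>p)" for n
  have step: "a n \<le> a (Suc n) + (\<integral>\<^sup>+x. survival K (Suc n) (1, snd x) \<partial>p)" for n
  proof -
    have pt: "(\<integral>\<^sup>+y. survival K n y \<partial>K x) \<le> survival K (Suc n) x + survival K (Suc n) (1, snd x)" for x
    proof (cases x)
      case (Pair k i)
      show ?thesis
      proof (cases "k = 0")
        case True
        have "(\<integral>\<^sup>+y. survival K n y \<partial>K (0, i)) \<le> (\<integral>\<^sup>+y. survival K n y \<partial>K (1, i))"
          by (rule level_monoD[OF monotone_kernelD[OF mono level_mono_survival[OF mono]]]) simp
        then show ?thesis using True Pair by simp
      qed (use Pair in simp)
    qed
    have "a n = (\<integral>\<^sup>+x. survival K n x \<partial>bind_pmf p K)" by (simp only: a_def stat)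
    also have "\<dots> = (\<integral>\<^sup>+x. \<integral>\<^sup>+y. survival K n y \<partial>K x \<partial>p)" by simp
    also have "\<dots> \<le> (\<integral>\<^sup>+x. survival K (Suc n) x + survival K (Suc n) (1, snd x) \<partial>p)"
      by (intro nn_integral_mono pt)
    also have "\<dots> = a (Suc n) + (\<integral>\<^sup>+x. survival K (Suc n) (1, snd x) \<partial>p)"
      unfolding a_def by (rule nn_integral_add) auto
    finally show ?thesis .
  qed
  have iter: "a m \<le> a (m + J) + (\<Sum>j<J. \<integral>\<^sup>+x. survival K (Suc (m + j)) (1, snd x) \<partial>p)" for J
  proof (induction J)
    case (Suc J)
    also have "a (m + J) + (\<Sum>j<J. \<integral>\<^sup>+x. survival K (Suc (m + j)) (1, snd x) \<partial>p)
        \<le> a (Suc (m + J)) + (\<integral>\<^sup>+x. survival K (Suc (m + J)) (1, snd x) \<partial>p)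
          + (\<Sum>j<J. \<integral>\<^sup>+x. survival K (Suc (m + j)) (1, snd x) \<partial>p)"
      by (intro add_right_mono step)
    finally show ?case by (simp add: ac_simps)
  qed simp
  \<comment> \<open>As \<open>R\<close> increases, \<open>R m\<close> is at most the weight of each
    survival term, and the weighted terms are part of the series already bounded for the start
    \<open>(1, i)\<close>.\<close>
  have ret: "ennreal (R m) * (\<Sum>j<J. \<integral>\<^sup>+x. survival K (Suc (m + j)) (1, snd x) \<partial>p) \<le> ennreal (w 1)" for J
  proof -
    have "ennreal (R m) * (\<Sum>j<J. survival K (Suc (m + j)) (1, i)) \<le> ennreal (w 1)" for i
    proof -
      have "ennreal (R m) * (\<Sum>j<J. survival K (Suc (m + j)) (1, i))
          \<le> (\<Sum>j<J. ennreal (R (Suc (m + j))) * survival K (Suc (m + j)) (1, i))"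
        unfolding sum_distrib_left using incseqD[OF R_mono]
        by (intro sum_mono mult_right_mono ennreal_leI) auto
      also have "\<dots> = (\<Sum>j\<in>(\<lambda>j. Suc (m + j)) ` {..<J}. ennreal (R j) * survival K j (1, i))"
        by (subst sum.reindex) (auto simp: inj_on_def)
      also have "\<dots> \<le> (\<Sum>j<Suc (m + J). ennreal (R j) * survival K j (1, i))"
        by (intro sum_mono2) auto
      also have "\<dots> \<le> ennreal (w 1)" using sums[where J = "Suc (m + J)" and x = "(1, i)"] by (simp only: fst_conv)
      finally show ?thesis .
    qed
    then have "(\<integral>\<^sup>+x. ennreal (R m) * (\<Sum>j<J. survival K (Suc (m + j)) (1, snd x)) \<partial>p) \<le> (\<integral>\<^sup>+x. ennreal (w 1) \<partial>p)"
      by (intro nn_integral_mono)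
    moreover have "(\<integral>\<^sup>+x. ennreal (R m) * (\<Sum>j<J. survival K (Suc (m + j)) (1, snd x)) \<partial>p)
        = ennreal (R m) * (\<Sum>j<J. \<integral>\<^sup>+x. survival K (Suc (m + j)) (1, snd x) \<partial>p)"
      by (subst nn_integral_cmult, simp, subst nn_integral_sum) (simp_all del: survival.simps)
    ultimately show ?thesis by (simp add: measure_pmf.emeasure_space_1 del: survival.simps)
  qed
  have bound: "ennreal (R m) * a m \<le> ennreal (R m) * a (m + J) + ennreal (w 1)" for J
  proof -
    have "ennreal (R m) * a m
        \<le> ennreal (R m) * (a (m + J) + (\<Sum>j<J. \<integral>\<^sup>+x. survival K (Suc (m + j)) (1, snd x) \<partial>p))"
      by (intro mult_left_mono iter) auto
    also have "\<dots> \<le> ennreal (R m) * a (m + J) + ennreal (w 1)"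
      unfolding distrib_left by (intro add_left_mono ret)
    finally show ?thesis .
  qed
  \<comment> \<open>The remainder of the telescoped sum vanishes: survival tends to \<open>0\<close>
    from every state and is dominated by \<open>1\<close>.\<close>
  have "a \<longlonglongrightarrow> (\<integral>\<^sup>+x. 0 \<partial>p)"
    unfolding a_def
  proof (rule nn_integral_dominated_convergence[where w = "\<lambda>_. 1"])
    show "AE x in p. (\<lambda>n. survival K n x) \<longlonglongrightarrow> 0"
      using incseqD[OF R_mono] by (intro AE_I2 survival_tendsto_0[OF R0 _ sums]) auto
  qed (auto simp: survival_le_1)
  then have "(\<lambda>J. a (m + J)) \<longlonglongrightarrow> 0"
    using LIMSEQ_ignore_initial_segment[of a 0 m] by (simp add: add.commute)
  then have "(\<lambda>J. ennreal (R m) * a (m + J) + ennreal (w 1)) \<longlonglongrightarrow> ennreal (R m) * 0 + ennreal (w 1)"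
    by (intro tendsto_add ennreal_tendsto_cmult tendsto_const) auto
  then have "ennreal (R m) * a m \<le> ennreal (R m) * 0 + ennreal (w 1)"
    by (rule LIMSEQ_le_const) (use bound in auto)
  then show ?thesis by (simp add: a_def)
qed

text \<open>Steps of \<open>K'\<close> are exchanged for steps of \<open>K\<close> one at a time.
  The exchange at time \<open>l\<close> costs \<open>err\<close> at the current position of the
  \<open>K'\<close> chain; the steps after it use \<open>K\<close>, so the integrand is still
  bounded by \<open>1\<close>.\<close>

lemma kernel_pow_perturbation:
  fixes K K' :: "'s \<Rightarrow> 's pmf" and f err :: "'s \<Rightarrow> ennreal"
  assumes err: "\<And>g x. (\<And>y. g y \<le> 1) \<Longrightarrow> (\<integral>\<^sup>+y. g y \<partial>K' x) \<le> (\<integral>\<^sup>+y. g y \<partial>K x) + err x"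
    and f: "\<And>y. f y \<le> 1"
  shows "(\<integral>\<^sup>+y. f y \<partial>kernel_pow K' m x) \<le> (\<integral>\<^sup>+y. f y \<partial>kernel_pow K m x) + (\<Sum>l<m. \<integral>\<^sup>+y. err y \<partial>kernel_pow K' l x)"
proof (induction m arbitrary: x)
  case (Suc m)
  have le1: "(\<integral>\<^sup>+y. f y \<partial>kernel_pow K m z) \<le> 1" for z
  proof -
    have "(\<integral>\<^sup>+y. f y \<partial>kernel_pow K m z) \<le> (\<integral>\<^sup>+y. 1 \<partial>kernel_pow K m z)"
      by (intro nn_integral_mono f)
    then show ?thesis by simp
  qed
  have "(\<integral>\<^sup>+y. f y \<partial>kernel_pow K' (Suc m) x) = (\<integral>\<^sup>+z. \<integral>\<^sup>+y. f y \<partial>kernel_pow K' m z \<partial>K' x)"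
    by (simp add: kernel_pow_Suc_left del: kernel_pow.simps)
  also have "\<dots> \<le> (\<integral>\<^sup>+z. (\<integral>\<^sup>+y. f y \<partial>kernel_pow K m z) + (\<Sum>l<m. \<integral>\<^sup>+y. err y \<partial>kernel_pow K' l z) \<partial>K' x)"
    by (intro nn_integral_mono Suc)
  also have "\<dots> = (\<integral>\<^sup>+z. \<integral>\<^sup>+y. f y \<partial>kernel_pow K m z \<partial>K' x)
      + (\<Sum>l<m. \<integral>\<^sup>+z. \<integral>\<^sup>+y. err y \<partial>kernel_pow K' l z \<partial>K' x)"
    by (simp add: nn_integral_add nn_integral_sum)
  also have "\<dots> \<le> (\<integral>\<^sup>+z. \<integral>\<^sup>+y. f y \<partial>kernel_pow K m z \<partial>K x) + err x
      + (\<Sum>l<m. \<integral>\<^sup>+z. \<integral>\<^sup>+y. err y \<partial>kernel_pow K' l z \<partial>K' x)"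
    by (intro add_right_mono err le1)
  also have "\<dots> = (\<integral>\<^sup>+y. f y \<partial>kernel_pow K (Suc m) x) + (\<Sum>l<Suc m. \<integral>\<^sup>+y. err y \<partial>kernel_pow K' l x)"
  proof -
    have "(\<Sum>l<Suc m. \<integral>\<^sup>+y. err y \<partial>kernel_pow K' l x)
        = err x + (\<Sum>l<m. \<integral>\<^sup>+z. \<integral>\<^sup>+y. err y \<partial>kernel_pow K' l z \<partial>K' x)"
      by (subst sum.lessThan_Suc_shift) (simp add: kernel_pow_Suc_left del: kernel_pow.simps(2))
    then show ?thesis by (simp add: kernel_pow_Suc_left add.assoc del: kernel_pow.simps(2))
  qed
  finally show ?case .
qed simp

section \<open>The drift function\<close>

text \<open>Derivatives are given on \<open>x > 0\<close> only. At the endpoint,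
  \<open>V_onto\<close> forces \<open>V 0 = 1\<close> and continuity, and \<open>V'_lim_0\<close>
  makes \<open>V'\<close> continuous. \<open>log_deriv_mono\<close> is the source of both concavity
  arguments: for the map from \<open>V u\<close> to \<open>V (u + s)\<close>, and for
  \<phi>.\<close>

locale drift_function =
  fixes V V' V'' :: "real \<Rightarrow> real"
  assumes V_ge_1: "0 \<le> x \<Longrightarrow> 1 \<le> V x"
    and V_mono: "strict_mono_on {0..} V"
    and V_convex: "convex_on {0..} V"
    and V_deriv: "0 < x \<Longrightarrow> (V has_real_derivative V' x) (at x)"
    and V'_deriv: "0 < x \<Longrightarrow> (V' has_real_derivative V'' x) (at x)"
    and V'_lim_0: "(V' \<longlongrightarrow> V' 0) (at_right 0)"
    and V'_0_pos: "0 < V' 0"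
    and log_deriv_mono: "0 < x \<Longrightarrow> x \<le> y \<Longrightarrow> V'' y / V' y \<le> V'' x / V' x"
    and V_onto: "{1..} \<subseteq> V ` {0..}"
begin

lemma V_less: "0 \<le> x \<Longrightarrow> x < y \<Longrightarrow> V x < V y"
  using strict_mono_onD[OF V_mono, of x y] by auto

lemma V_le: "0 \<le> x \<Longrightarrow> x \<le> y \<Longrightarrow> V x \<le> V y"
  using V_less[of x y] by (cases "x = y") auto

lemma V_0: "V 0 = 1"
proof -
  have "1 \<in> V ` {0..}" using V_onto by auto
  then obtain x where "0 \<le> x" "V x = 1" by auto
  then show ?thesis using V_le[of 0 x] V_ge_1[of 0] by simp
qed

lemma continuous_on_V: "continuous_on {0..} V"
  unfolding continuous_on_eq_continuous_within
proof
  fix x :: real assume "x \<in> {0..}"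
  show "continuous (at x within {0..}) V"
  proof (cases "x = 0")
    case False
    then have "0 < x" using \<open>x \<in> {0..}\<close> by simp
    from DERIV_isCont[OF V_deriv[OF this]] show ?thesis
      by (rule continuous_at_imp_continuous_at_within)
  next
    case True
    show ?thesis
      unfolding True continuous_within_eps_delta
    proof (intro allI impI)
      \<comment> \<open>Continuity at \<open>0\<close> comes from surjectivity: \<open>V\<close> is
        increasing and attains \<open>1 + e\<close> at some \<open>y > 0\<close>, so it stays below
        \<open>1 + e\<close> before \<open>y\<close>.\<close>
      fix e :: real assume "0 < e"
      then have "1 + e \<in> V ` {0..}" using V_onto by auto
      then obtain y where y: "0 \<le> y" "V y = 1 + e" by auto
      then have "y \<noteq> 0" using V_0 \<open>0 < e\<close> by auto
      have "dist (V x) (V 0) < e" if "x \<in> {0..}" "dist x 0 < y" for x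
        using that V_less[of x y] V_ge_1[of x] y by (auto simp: dist_real_def V_0)
      then show "\<exists>d>0. \<forall>x\<in>{0..}. dist x 0 < d \<longrightarrow> dist (V x) (V 0) < e"
        using y \<open>y \<noteq> 0\<close> by (intro exI[of _ y]) auto
    qed
  qed
qed

text \<open>Adding the tangent inequalities of the convex \<open>V\<close> at \<open>a\<close> and
  at \<open>b\<close> gives \<open>(V' b - V' a) * (b - a) \<ge> 0\<close>; the endpoint
  \<open>0\<close> follows by the right limit.\<close>

lemma V'_mono: assumes "0 \<le> x" "x \<le> y" shows "V' x \<le> V' y"
proof -
  have tangent: "V' c * (z - c) \<le> V z - V c" if "0 < c" "0 < z" for c z
    using that V_deriv
    by (intro convex_on_imp_above_tangent[OF V_convex]) (auto intro: has_field_derivative_at_within)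
  have pos: "V' a \<le> V' b" if "0 < a" "a \<le> b" for a b
  proof (cases "a = b")
    case False
    have "0 \<le> (V' b - V' a) * (b - a)"
      using tangent[of a b] tangent[of b a] that by (simp add: algebra_simps)
    then show ?thesis using False that by (simp add: zero_le_mult_iff)
  qed simp
  show ?thesis
  proof (cases "0 < x")
    case False
    with assms have [simp]: "x = 0" by simp
    show ?thesis
    proof (cases "y = 0")
      case False
      have "eventually (\<lambda>t. V' t \<le> V' y) (at_right 0)"
        unfolding eventually_at_right_field using False assms
        by (intro exI[of _ y]) (auto intro!: pos)
      then show ?thesis using tendsto_upperbound[OF V'_lim_0] by simp
    qed simp
  qed (use assms pos in auto)
qed

lemma V'_pos: "0 \<le> x \<Longrightarrow> 0 < V' x"
  using V'_mono[of 0 x] V'_0_pos by simp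

lemma V_diff_bounds:
  assumes "0 \<le> x" "x \<le> y"
  shows "V' x * (y - x) \<le> V y - V x" and "V y - V x \<le> V' y * (y - x)"
proof -
  have "V' x * (y - x) \<le> V y - V x \<and> V y - V x \<le> V' y * (y - x)"
  proof (cases "x = y")
    case False
    then have "x < y" using assms by simp
    have "\<exists>l z. x < z \<and> z < y \<and> DERIV V z :> l \<and> V y - V x = (y - x) * l"
    proof (rule MVT[OF \<open>x < y\<close>])
      show "continuous_on {x..y} V"
        using continuous_on_V assms by (rule_tac continuous_on_subset) auto
      show "V differentiable (at z)" if "x < z" "z < y" for z
        using V_deriv[of z] that assms by (auto simp: real_differentiable_def)
    qed
    then obtain l z where z: "x < z" "z < y" "DERIV V z :> l" "V y - V x = (y - x) * l" by blast
    have "l = V' z" using z assms V_deriv[of z] by (intro DERIV_unique) auto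
    moreover have "V' x * (y - x) \<le> V' z * (y - x)" "V' z * (y - x) \<le> V' y * (y - x)"
      using z assms by (auto intro!: mult_right_mono V'_mono)
    ultimately show ?thesis using z by (simp add: mult.commute)
  qed simp
  then show "V' x * (y - x) \<le> V y - V x" and "V y - V x \<le> V' y * (y - x)" by auto
qed

lemma V'_continuous_on: "continuous_on {0..} V'"
  unfolding continuous_on_eq_continuous_within
proof
  fix x :: real assume "x \<in> {0..}"
  show "continuous (at x within {0..}) V'"
  proof (cases "x = 0")
    case False
    then have "0 < x" using \<open>x \<in> {0..}\<close> by simp
    from DERIV_isCont[OF V'_deriv[OF this]] show ?thesis
      by (rule continuous_at_imp_continuous_at_within)
  qed (use V'_lim_0 in \<open>simp add: continuous_within at_within_Ici_at_right\<close>)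
qed

text \<open>The logarithm of the ratio has as derivative the difference of \<open>V'' / V'\<close>
  at \<open>z + s\<close> and at \<open>z\<close>, which is nonpositive.\<close>

lemma V'_shift_ratio_mono:
  assumes "0 \<le> s" "0 < x" "x \<le> y"
  shows "V' (y + s) / V' y \<le> V' (x + s) / V' x"
proof -
  have "ln (V' (y + s)) - ln (V' y) \<le> ln (V' (x + s)) - ln (V' x)"
  proof (rule DERIV_nonpos_imp_nonincreasing[OF \<open>x \<le> y\<close>])
    fix z assume z: "x \<le> z" "z \<le> y"
    have p: "0 < V' z" "0 < V' (z + s)" using assms z by (auto intro!: V'_pos)
    have "((\<lambda>x. V' (x + s)) has_real_derivative V'' (z + s)) (at z)"
      using V'_deriv[of "z + s"] assms z by (intro DERIV_shift[THEN iffD1]) simp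
    then have "((\<lambda>x. ln (V' (x + s)) - ln (V' x)) has_real_derivative
        V'' (z + s) / V' (z + s) - V'' z / V' z) (at z)"
      using p V'_deriv[of z] assms z
      by (intro DERIV_diff DERIV_ln_divide[THEN DERIV_chain2, THEN DERIV_cong]) auto
    moreover have "V'' (z + s) / V' (z + s) - V'' z / V' z \<le> 0"
      using log_deriv_mono[of z "z + s"] assms z by simp
    ultimately show "\<exists>d. ((\<lambda>x. ln (V' (x + s)) - ln (V' x)) has_real_derivative d) (at z) \<and> d \<le> 0" by blast
  qed
  moreover have p: "0 < V' x" "0 < V' y" "0 < V' (x + s)" "0 < V' (y + s)"
    using assms by (auto intro!: V'_pos)
  ultimately have "ln (V' (y + s) / V' y) \<le> ln (V' (x + s) / V' x)" by (simp add: ln_div)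
  then show ?thesis using p by (subst (asm) ln_le_cancel_iff) auto
qed

text \<open>This is the tangent inequality for the concave function that maps \<open>V u\<close> to \<open>V (u + s)\<close>.\<close>

lemma V_shift_tangent:
  assumes "0 \<le> s" "0 < u" "0 \<le> z"
  shows "V (z + s) - V (u + s) \<le> V' (u + s) / V' u * (V z - V u)"
proof -
  define \<rho> where "\<rho> = V' (u + s) / V' u"
  \<comment> \<open>The gap between the shifted function and the line of slope \<rho>. Its
    derivative is \<open>V' x\<close> times the difference of the shift ratios at \<open>x\<close>
    and at \<open>u\<close>, so it changes sign from plus to minus at \<open>u\<close>, where
    \<open>D\<close> is maximal.\<close>
  define D where "D x = V (x + s) - \<rho> * V x" for x
  have D_deriv: "(D has_real_derivative (V' (x + s) - \<rho> * V' x)) (at x)" if "0 < x" for x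
  proof -
    have "((\<lambda>x. V (x + s)) has_real_derivative V' (x + s)) (at x)"
      using V_deriv[of "x + s"] assms that by (intro DERIV_shift[THEN iffD1]) simp
    then show ?thesis
      unfolding D_def using V_deriv[OF that] by (auto intro!: derivative_eq_intros)
  qed
  have D_cont: "continuous_on {a..b} D" if "0 \<le> a" for a b
    unfolding D_def using that assms
    by (intro continuous_intros continuous_on_compose2[OF continuous_on_V]) auto
  have sgn: "V' (x + s) - \<rho> * V' x = V' x * (V' (x + s) / V' x - \<rho>)" if "0 < x" for x
    using V'_pos[of x] that by (simp add: field_simps)
  have "D z \<le> D u"
  proof (cases "z \<le> u")
    case True
    show ?thesis
    proof (rule DERIV_nonneg_imp_increasing_open[OF True])
      fix x assume x: "z < x" "x < u"
      then have "0 \<le> V' (x + s) - \<rho> * V' x"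
        using assms V'_shift_ratio_mono[of s x u] V'_pos[of x]
        by (subst sgn) (auto simp: \<rho>_def)
      then show "\<exists>d. (D has_real_derivative d) (at x) \<and> 0 \<le> d"
        using D_deriv[of x] x assms by auto
    qed (rule D_cont[OF assms(3)])
  next
    case False
    then have "u \<le> z" by simp
    then show ?thesis
    proof (rule DERIV_nonpos_imp_decreasing_open)
      fix x assume x: "u < x" "x < z"
      then have "V' (x + s) - \<rho> * V' x \<le> 0"
        using assms V'_shift_ratio_mono[of s u x] V'_pos[of x]
        by (subst sgn) (auto simp: \<rho>_def mult_le_0_iff)
      then show "\<exists>d. (D has_real_derivative d) (at x) \<and> d \<le> 0"
        using D_deriv[of x] x assms by auto
    qed (use D_cont[of u] assms in auto)
  qed
  then show ?thesis unfolding D_def \<rho>_def[symmetric] by (simp add: algebra_simps)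
qed

section \<open>The inverse of \<open>V\<close> and the rate function\<close>

abbreviation V_inv :: "real \<Rightarrow> real" where
  "V_inv \<equiv> the_inv_into {0..} V"

lemma inj_on_V: "inj_on V {0..}"
  using V_mono by (rule strict_mono_on_imp_inj_on)

lemma V_inv_V: "0 \<le> x \<Longrightarrow> V_inv (V x) = x"
  using the_inv_into_f_f[OF inj_on_V] by simp

lemma V_V_inv: "1 \<le> t \<Longrightarrow> V (V_inv t) = t"
  using V_onto by (intro f_the_inv_into_f[OF inj_on_V]) auto

lemma V_inv_nonneg: "1 \<le> t \<Longrightarrow> 0 \<le> V_inv t"
  using the_inv_into_into[OF inj_on_V, of t "{0..}"] V_onto by auto

lemma V_inv_less: "1 \<le> t \<Longrightarrow> t < t' \<Longrightarrow> V_inv t < V_inv t'"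
  using V_le[of "V_inv t'" "V_inv t"] V_inv_nonneg[of t'] V_V_inv[of t] V_V_inv[of t'] by force

lemma V_inv_le: "1 \<le> t \<Longrightarrow> t \<le> t' \<Longrightarrow> V_inv t \<le> V_inv t'"
  using V_inv_less[of t t'] by (cases "t = t'") auto

lemma V_inv_1: "V_inv 1 = 0"
  using V_inv_V[of 0] V_0 by simp

text \<open>The slope of \<open>V\<close> is at least \<open>V' 0 > 0\<close>, so the inverse is
  Lipschitz with constant \<open>1 / V' 0\<close>, also at the endpoint \<open>1\<close>.\<close>

lemma V_inv_continuous_on: "continuous_on {1..} V_inv"
proof -
  have "dist (V_inv a) (V_inv b) \<le> (1 / V' 0) * dist a b" if "1 \<le> a" "1 \<le> b" for a b
  proof -
    have *: "\<bar>V_inv a - V_inv b\<bar> \<le> (1 / V' 0) * (b - a)" if "1 \<le> a" "a \<le> b" for a b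
    proof -
      have "V' 0 * (V_inv b - V_inv a) \<le> V' (V_inv a) * (V_inv b - V_inv a)"
        using that V_inv_nonneg[of a] V_inv_le[of a b] by (intro mult_right_mono V'_mono) auto
      also have "\<dots> \<le> b - a"
        using V_diff_bounds(1)[of "V_inv a" "V_inv b"] that V_inv_nonneg[of a] V_inv_le[of a b]
        by (simp add: V_V_inv)
      finally show ?thesis
        using that V_inv_le[of a b] V'_0_pos by (simp add: field_simps)
    qed
    show ?thesis
      using *[of a b] *[of b a] that by (cases "a \<le> b") (auto simp: dist_real_def abs_minus_commute)
  qed
  then have "(1 / V' 0)-lipschitz_on {1..} V_inv"
    using V'_0_pos by (intro lipschitz_onI) auto
  then show ?thesis by (rule lipschitz_on_continuous_on)
qed

lemma V_inv_deriv:
  assumes "1 < t"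
  shows "(V_inv has_real_derivative inverse (V' (V_inv t))) (at t)"
proof -
  have p: "0 < V_inv t" using V_inv_less[of 1 t] V_inv_1 assms by simp
  show ?thesis
  proof (rule DERIV_inverse_function[where f = V and a = 1 and b = "t + 1"])
    show "isCont V_inv t"
      using V_inv_continuous_on assms
      by (rule_tac continuous_on_interior[of "{1..}"]) auto
    show "DERIV V (V_inv t) :> V' (V_inv t)" by (rule V_deriv[OF p])
    show "V' (V_inv t) \<noteq> 0" using V'_pos[of "V_inv t"] p by simp
  qed (use assms V_V_inv in auto)
qed

context
  fixes \<kappa> :: real and \<phi> :: "real \<Rightarrow> real"
  assumes \<kappa>: "0 < \<kappa>" and \<phi>: "\<phi> = phi_of \<kappa> V V'"
begin

lemma phi_V: "0 \<le> x \<Longrightarrow> \<phi> (V x) = \<kappa> * V' x"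
  by (simp add: \<phi> phi_of_def V_inv_V)

lemma phi_pos: "1 \<le> t \<Longrightarrow> 0 < \<phi> t"
  using \<kappa> V_inv_nonneg[of t] V'_pos by (auto simp: \<phi> phi_of_def)

text \<open>Since \<open>\<phi> t = \<kappa> * V' (V_inv t)\<close>, the function
  \<open>V_inv / \<kappa>\<close> is an antiderivative of \<open>1 / \<phi>\<close>.\<close>

lemma H_fun_V:
  assumes "0 \<le> x"
  shows "H_fun \<phi> (V x) = x / \<kappa>"
proof -
  have "((\<lambda>t. 1 / \<phi> t) has_integral (V_inv (V x) / \<kappa> - V_inv 1 / \<kappa>)) {1..V x}"
  proof (rule fundamental_theorem_of_calculus_interior)
    show "1 \<le> V x" using assms by (rule V_ge_1)
    show "continuous_on {1..V x} (\<lambda>t. V_inv t / \<kappa>)"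
      using \<kappa> by (intro continuous_on_divide continuous_on_const continuous_on_subset[OF V_inv_continuous_on]) auto
    fix t assume t: "t \<in> {1<..<V x}"
    then have "((\<lambda>t. V_inv t / \<kappa>) has_real_derivative inverse (V' (V_inv t)) / \<kappa>) (at t)"
      by (intro DERIV_cdivide V_inv_deriv) auto
    then show "((\<lambda>t. V_inv t / \<kappa>) has_vector_derivative 1 / \<phi> t) (at t)"
      by (simp add: has_real_derivative_iff_has_vector_derivative \<phi> phi_of_def field_simps)
  qed
  then show ?thesis using assms by (simp add: H_fun_def integral_unique V_inv_V V_inv_1)
qed

lemma r_fun_eq:
  assumes "0 \<le> t"
  shows "r_fun \<phi> t = \<kappa> * V' (\<kappa> * t)"
proof -
  have H: "H_fun \<phi> y = V_inv y / \<kappa>" if "1 \<le> y" for y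
    using H_fun_V[of "V_inv y"] that by (simp add: V_V_inv V_inv_nonneg)
  have "inj_on (H_fun \<phi>) {1..}"
  proof (rule inj_onI)
    fix y z assume "y \<in> {1..}" "z \<in> {1..}" "H_fun \<phi> y = H_fun \<phi> z"
    then have yz: "1 \<le> y" "1 \<le> z" "V_inv y / \<kappa> = V_inv z / \<kappa>" by (auto simp only: H atLeast_iff)
    then have "V (V_inv y) = V (V_inv z)" using \<kappa> by (simp only: divide_cancel_right) auto
    then show "y = z" by (simp only: V_V_inv[OF yz(1)] V_V_inv[OF yz(2)])
  qed
  then have "the_inv_into {1..} (H_fun \<phi>) t = V (\<kappa> * t)"
  proof (rule the_inv_into_f_eq)
    show "H_fun \<phi> (V (\<kappa> * t)) = t" using assms \<kappa> by (subst H_fun_V) auto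
    show "V (\<kappa> * t) \<in> {1..}" using assms \<kappa> V_ge_1[of "\<kappa> * t"] by simp
  qed
  then have "r_fun \<phi> t = \<phi> (V (\<kappa> * t))" by (simp only: r_fun_def)
  also have "\<dots> = \<kappa> * V' (\<kappa> * t)" using assms \<kappa> by (intro phi_V) simp
  finally show ?thesis .
qed

text \<open>As \<open>\<phi>\<close> is concave, its increments over intervals of length \<open>B\<close> decrease.\<close>

lemma c_fun_phi_le:
  assumes "0 \<le> x" "0 < B"
  shows "c_fun \<phi> B 1 * \<phi> (V x + B) \<le> \<phi> (V x)"
proof -
  define y where "y x = V_inv (V x + B)" for x
  have Vx: "1 \<le> V x + B" if "0 \<le> x" for x using V_ge_1[OF that] assms by simp
  have y_ge: "x \<le> y x" if "0 \<le> x" for x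
    using V_inv_le[of "V x" "V x + B"] V_ge_1[OF that] assms that by (simp add: y_def V_inv_V)
  \<comment> \<open>Up to the factor \<kappa>, this is the increment of \<phi> from
    \<open>V x\<close> to \<open>V x + B\<close>.\<close>
  define E where "E x = V' (y x) - V' x" for x
  have "E x \<le> E 0"
  proof (rule DERIV_nonpos_imp_decreasing_open[OF assms(1)])
    fix z assume z: "0 < z" "z < x"
    then have "((\<lambda>x. V x + B) has_real_derivative V' z) (at z)"
      by (auto intro!: derivative_eq_intros V_deriv)
    moreover have "1 < V z + B" using V_ge_1[of z] z assms by simp
    ultimately have "(y has_real_derivative inverse (V' (y z)) * V' z) (at z)"
      unfolding y_def by (intro DERIV_chain2[of V_inv] V_inv_deriv)
    then have "((\<lambda>x. V' (y x)) has_real_derivative V'' (y z) * (inverse (V' (y z)) * V' z)) (at z)"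
      using z y_ge[of z] by (intro DERIV_chain2[of V'] V'_deriv) auto
    then have "(E has_real_derivative V'' (y z) * (inverse (V' (y z)) * V' z) - V'' z) (at z)"
      unfolding E_def using V'_deriv[of z] z by (intro DERIV_diff) auto
    moreover have "V'' (y z) * (inverse (V' (y z)) * V' z) - V'' z
        = V' z * (V'' (y z) / V' (y z) - V'' z / V' z)"
      using V'_pos[of z] z by (simp add: field_simps)
    moreover have "\<dots> \<le> 0"
      using V'_pos[of z] z y_ge[of z] log_deriv_mono[of z "y z"] by (simp add: mult_le_0_iff)
    ultimately show "\<exists>d. (E has_real_derivative d) (at z) \<and> d \<le> 0" by metis
  next
    have "continuous_on {0..x} y"
      unfolding y_def using Vx
      by (intro continuous_on_compose2[OF V_inv_continuous_on] continuous_intros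
          continuous_on_subset[OF continuous_on_V]) auto
    moreover have "y ` {0..x} \<subseteq> {0..}" by (auto intro: order_trans[OF _ y_ge])
    ultimately have "continuous_on {0..x} (\<lambda>x. V' (y x))"
      by (rule continuous_on_compose2[OF V'_continuous_on])
    moreover have "continuous_on {0..x} V'"
      by (rule continuous_on_subset[OF V'_continuous_on]) auto
    ultimately show "continuous_on {0..x} E"
      unfolding E_def by (rule continuous_on_diff)
  qed
  moreover have "V' 0 \<le> V' (y 0)" using y_ge[of 0] by (intro V'_mono) auto
  moreover have "V' 0 \<le> V' x" using assms by (intro V'_mono) auto
  \<comment> \<open>The additive bound \<open>E x \<le> E 0\<close> becomes one for ratios:
    \<open>E 0\<close> is nonnegative and \<open>V' 0 \<le> V' x\<close>, so the relative growth of
    \<phi> over the interval is largest at \<open>x = 0\<close>.\<close>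
  ultimately have "V' 0 * (V' (y x) - V' x) \<le> V' 0 * (V' (y 0) - V' 0)"
    "V' 0 * (V' (y 0) - V' 0) \<le> V' x * (V' (y 0) - V' 0)"
    using V'_0_pos by (auto simp: E_def intro!: mult_left_mono mult_right_mono)
  then have "V' 0 * (V' (y x) - V' x) \<le> V' x * (V' (y 0) - V' 0)" by (rule order_trans)
  then have "V' 0 * V' (y x) \<le> V' (y 0) * V' x" by (simp add: algebra_simps)
  moreover have "\<phi> 1 = \<kappa> * V' 0" "\<phi> (B + 1) = \<kappa> * V' (y 0)" "\<phi> (V x + B) = \<kappa> * V' (y x)" "\<phi> (V x) = \<kappa> * V' x"
    using assms by (simp_all add: \<phi> phi_of_def y_def V_inv_V V_inv_1 V_0 add.commute)
  moreover have "0 < V' (y 0)" using y_ge[of 0] by (intro V'_pos) auto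
  ultimately show ?thesis
    using \<kappa> by (simp add: c_fun_def field_simps)
qed

end

end

section \<open>Stationary distributions of monotone kernels\<close>

text \<open>Measuring levels by \<open>u\<close> and speed by \<eta> lets one statement serve both
  bounds: \<open>u = real\<close> and \<open>\<eta> = \<kappa>\<close> if \<open>K = 0\<close>; in
  general, \<open>V (u l) = V l + \<beta>\<close> for \<open>l > 0\<close> and
  \<open>\<eta> = c * \<kappa>\<close> with \<open>c = c_fun \<phi> \<beta> 1\<close>.\<close>

lemma (in drift_function) survival_bound:
  fixes K :: "nat \<times> 'd \<Rightarrow> (nat \<times> 'd) pmf" and u :: "nat \<Rightarrow> real"
  assumes mono: "monotone_kernel K" and stat: "bind_pmf p K = p" and \<eta>: "0 < \<eta>"
    and u0: "0 \<le> u 0" and u_pos: "\<And>l. 0 < l \<Longrightarrow> 0 < u l"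
    and drift: "\<And>x :: nat \<times> 'd. fst x \<noteq> 0 \<Longrightarrow>
      (\<integral>\<^sup>+y. ennreal (V (u (fst y))) \<partial>K x) + ennreal (\<eta> * V' (u (fst x))) \<le> ennreal (V (u (fst x)))"
  shows "(\<integral>\<^sup>+x. survival K m x \<partial>p) \<le> ennreal (V (u 1) / (\<eta> * V' (\<eta> * real m)))"
proof -
  define R where "R n = \<eta> * V' (\<eta> * real n)" for n
  define F where "F n x = V (u (fst x) + \<eta> * real n) - V (\<eta> * real n)" for n and x :: "nat \<times> 'd"
  have u_nonneg: "0 \<le> u l" for l using u0 u_pos[of l] by (cases "l = 0") auto
  have F_drift: "(\<integral>\<^sup>+y. ennreal (F (Suc n) y) \<partial>K x) + ennreal (R n) \<le> ennreal (F n x)"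
    if x: "fst x \<noteq> 0" for n and x :: "nat \<times> 'd"
  proof -
    define v where "v = u (fst x)"
    define s where "s = \<eta> * real n"
    define s' where "s' = \<eta> * real (Suc n)"
    \<comment> \<open>The slope at \<open>V v\<close> of the concave map from \<open>V z\<close> to
      \<open>V (z + s')\<close>, as in \<open>V_shift_tangent\<close>.\<close>
    define \<rho> where "\<rho> = V' (v + s') / V' v"
    have s: "0 \<le> s" "s \<le> s'" "s' = s + \<eta>" "0 \<le> s'" using \<eta> by (auto simp: s_def s'_def algebra_simps)
    have v: "0 < v" using x u_pos by (simp add: v_def)
    have V'v: "0 < V' v" "0 < V' (v + s')" using v s by (auto intro!: V'_pos)
    have \<rho>: "0 \<le> \<rho>" using V'v by (simp add: \<rho>_def)
    have Vpos: "0 < V (u l + t)" "0 < V t" "0 < V (u l)" if "0 \<le> t" for l t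
      using V_ge_1[of "u l + t"] V_ge_1[of t] V_ge_1[of "u l"] u_nonneg[of l] that by auto
    have "(\<integral>\<^sup>+y. ennreal (V (u (fst y))) \<partial>K x) \<le> ennreal (V v)"
      using drift[OF x] unfolding v_def by (rule order_trans[rotated]) simp
    then obtain I where I: "(\<integral>\<^sup>+y. ennreal (V (u (fst y))) \<partial>K x) = ennreal I" "0 \<le> I"
      by (metis ennreal_cases ennreal_less_top leD)
    have I_le: "I + \<eta> * V' v \<le> V v"
      using drift[OF x] \<eta> V'v v I(2) Vpos(3)[of 0 "fst x"]
      unfolding I v_def[symmetric] by (simp add: ennreal_plus[symmetric] del: ennreal_plus)
    \<comment> \<open>The subtracted terms are kept on the left because subtraction in
      \<open>ennreal\<close> truncates at \<open>0\<close>.\<close>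
    have "(\<integral>\<^sup>+y. ennreal (F (Suc n) y) \<partial>K x) + ennreal (V s') + ennreal (\<rho> * V v)
        = (\<integral>\<^sup>+y. ennreal (F (Suc n) y) + ennreal (V s') + ennreal (\<rho> * V v) \<partial>K x)"
      by (simp add: nn_integral_add)
    also have "\<dots> \<le> (\<integral>\<^sup>+y. ennreal (V (v + s')) + ennreal \<rho> * ennreal (V (u (fst y))) \<partial>K x)"
    proof (rule nn_integral_mono)
      fix y :: "nat \<times> 'd"
      have "V (u (fst y) + s') - V (v + s') \<le> \<rho> * (V (u (fst y)) - V v)"
        unfolding \<rho>_def by (rule V_shift_tangent) (use s v u_nonneg in auto)
      then have "F (Suc n) y + V s' + \<rho> * V v \<le> V (v + s') + \<rho> * V (u (fst y))"
        by (simp add: F_def s'_def algebra_simps)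
      moreover have "0 \<le> F (Suc n) y"
        unfolding F_def using V_le[of s' "u (fst y) + s'"] s u_nonneg[of "fst y"] by (simp add: s'_def)
      ultimately show "ennreal (F (Suc n) y) + ennreal (V s') + ennreal (\<rho> * V v)
          \<le> ennreal (V (v + s')) + ennreal \<rho> * ennreal (V (u (fst y)))"
        using \<rho> Vpos(2)[OF s(4)] Vpos(2)[of v] Vpos(2)[of "v + s'"] v s Vpos(3)[of 0 "fst y"]
        by (simp add: ennreal_plus[symmetric] ennreal_mult[symmetric] del: ennreal_plus)
    qed
    also have "\<dots> = ennreal (V (v + s') + \<rho> * I)"
      using \<rho> I Vpos(2)[of "v + s'"] v s
      by (simp add: nn_integral_add nn_integral_cmult ennreal_plus[symmetric] ennreal_mult[symmetric] del: ennreal_plus)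
    finally have le: "(\<integral>\<^sup>+y. ennreal (F (Suc n) y) \<partial>K x) + ennreal (V s') + ennreal (\<rho> * V v) \<le> ennreal (V (v + s') + \<rho> * I)" .
    then have "(\<integral>\<^sup>+y. ennreal (F (Suc n) y) \<partial>K x) \<le> ennreal (V (v + s') + \<rho> * I)"
      by (rule order_trans[rotated]) (simp add: add.assoc)
    then obtain f where f: "(\<integral>\<^sup>+y. ennreal (F (Suc n) y) \<partial>K x) = ennreal f" "0 \<le> f"
      by (metis ennreal_cases ennreal_less_top leD)
    have "f + V s' + \<rho> * V v \<le> V (v + s') + \<rho> * I"
      using le f(2) \<rho> Vpos(2)[OF s(4)] Vpos(2)[of v] Vpos(2)[of "v + s'"] v s I(2) unfolding f(1)
      by (simp add: ennreal_plus[symmetric] del: ennreal_plus)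
    \<comment> \<open>Multiplied by \<rho>, the drift \<open>\<eta> * V' v\<close> is exactly
      \<open>\<eta> * V' (v + s')\<close>, which pays for the increase from \<open>V (v + s)\<close>
      to \<open>V (v + s')\<close>. The subtracted term grows by at least
      \<open>\<eta> * V' s\<close>, and this is \<open>R n\<close>.\<close>
    moreover have "\<rho> * I \<le> \<rho> * (V v - \<eta> * V' v)"
      using I_le \<rho> by (intro mult_left_mono) auto
    moreover have "\<rho> * (V v - \<eta> * V' v) = \<rho> * V v - \<eta> * V' (v + s')"
    proof -
      have "\<rho> * V' v = V' (v + s')" using V'v by (simp add: \<rho>_def)
      then show ?thesis by (simp add: right_diff_distrib mult.left_commute)
    qed
    moreover have "V (v + s') - V (v + s) \<le> V' (v + s') * \<eta>"
      using V_diff_bounds(2)[of "v + s" "v + s'"] s v by (simp add: algebra_simps)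
    moreover have "V' s * \<eta> \<le> V s' - V s"
      using V_diff_bounds(1)[of s s'] s by (simp add: algebra_simps)
    ultimately have "f + R n \<le> F n x"
      unfolding R_def F_def s_def[symmetric] v_def[symmetric] by (simp add: mult.commute)
    then show ?thesis
      using f(2) \<eta> V'_pos[OF s(1)] unfolding f(1)
      by (simp add: ennreal_plus[symmetric] R_def s_def ennreal_leI del: ennreal_plus)
  qed
  have R_pos: "0 < R n" for n using \<eta> V'_pos[of "\<eta> * real n"] by (simp add: R_def)
  have sums: "(\<Sum>j<J. ennreal (R j) * survival K j x) \<le> ennreal (V (u (fst x)) - V 0)"
    for J and x :: "nat \<times> 'd"
    using sum_survival_le[where R = "\<lambda>n. ennreal (R n)" and F = "\<lambda>n x. ennreal (F n x)" and K = K and n = 0, OF F_drift]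
    by (simp add: F_def)
  have "incseq R"
    unfolding R_def using \<eta> by (intro monoI mult_left_mono V'_mono) auto
  then have "ennreal (R m) * (\<integral>\<^sup>+x. survival K m x \<partial>p) \<le> ennreal (V (u 1) - V 0)"
    using stationary_survival_le[where w = "\<lambda>l. V (u l) - V 0", OF mono stat R_pos _ sums] by simp
  also have "\<dots> \<le> ennreal (V (u 1))" using V_ge_1[of 0] by (intro ennreal_leI) simp
  finally have *: "ennreal (R m) * (\<integral>\<^sup>+x. survival K m x \<partial>p) \<le> ennreal (V (u 1))" .
  have "(\<integral>\<^sup>+x. survival K m x \<partial>p) = ennreal (1 / R m) * (ennreal (R m) * (\<integral>\<^sup>+x. survival K m x \<partial>p))"
    using R_pos[of m] by (simp add: mult.assoc[symmetric] ennreal_mult[symmetric])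
  also have "\<dots> \<le> ennreal (1 / R m) * ennreal (V (u 1))" by (intro mult_left_mono *) simp
  also have "\<dots> = ennreal (V (u 1) / R m)"
    using R_pos[of m] V_ge_1[of "u 1"] u_nonneg[of 1] by (simp add: ennreal_mult[symmetric])
  finally show ?thesis by (simp add: R_def)
qed

section \<open>The phase process\<close>

text \<open>The probabilities of a set of phases and of its complement both increase with the level,
  while their sum stays \<open>1\<close>.\<close>

lemma monotone_kernel_phase:
  assumes "monotone_kernel K"
  shows "map_pmf snd (K (k, i)) = map_pmf snd (K (0, i))"
proof (rule pmf_eqI)
  have le: "measure_pmf.prob (K (0, i)) (snd -` S) \<le> measure_pmf.prob (K (k, i)) (snd -` S)" for S
  proof -
    have "level_mono (indicator (snd -` S) :: nat \<times> 'a \<Rightarrow> ennreal)"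
      by (auto simp: level_mono_def indicator_def)
    from level_monoD[OF monotone_kernelD[OF assms this], of 0 k i]
    show ?thesis by (simp add: measure_pmf.emeasure_eq_measure)
  qed
  fix j
  have "measure_pmf.prob (K (0, i)) (snd -` (- {j})) = 1 - measure_pmf.prob (K (0, i)) (snd -` {j})"
    "measure_pmf.prob (K (k, i)) (snd -` (- {j})) = 1 - measure_pmf.prob (K (k, i)) (snd -` {j})"
    using measure_pmf.prob_compl[of "snd -` {j}" "K (0, i)"] measure_pmf.prob_compl[of "snd -` {j}" "K (k, i)"]
    by (simp_all add: vimage_Compl Compl_eq_Diff_UNIV[symmetric])
  then show "pmf (map_pmf snd (K (k, i))) j = pmf (map_pmf snd (K (0, i))) j"
    using le[of "{j}"] le[of "- {j}"] by (simp add: pmf_map)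
qed

text \<open>The law of the next phase does not depend on the level, so the phase is a Markov chain
  by itself and inherits stationarity.\<close>

lemma stationary_phase:
  assumes "monotone_kernel K" and "bind_pmf p K = p"
  shows "bind_pmf (map_pmf snd p) (\<lambda>i. map_pmf snd (K (0, i))) = map_pmf snd p"
proof -
  have "bind_pmf (map_pmf snd p) (\<lambda>i. map_pmf snd (K (0, i))) = bind_pmf p (\<lambda>x. map_pmf snd (K x))"
    unfolding bind_map_pmf
  proof (intro bind_pmf_cong refl)
    fix x show "map_pmf snd (K (0, snd x)) = map_pmf snd (K x)"
      using monotone_kernel_phase[OF assms(1), of "fst x" "snd x"] by simp
  qed
  also have "\<dots> = map_pmf snd (bind_pmf p K)" by (simp only: map_bind_pmf)
  finally show ?thesis by (simp only: assms(2))
qed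

text \<open>The positive part of a signed invariant vector is again invariant, so its support is closed.\<close>

lemma finite_stationary_unique:
  fixes \<Lambda> :: "'d::finite \<Rightarrow> 'd pmf"
  assumes p: "bind_pmf p \<Lambda> = p" and q: "bind_pmf q \<Lambda> = q"
    and irred: "\<And>S. (\<And>i. i \<in> S \<Longrightarrow> set_pmf (\<Lambda> i) \<subseteq> S) \<Longrightarrow> S = {} \<or> S = UNIV"
  shows "p = q"
proof -
  have bind: "pmf (bind_pmf r \<Lambda>) j = (\<Sum>i\<in>UNIV. pmf r i * pmf (\<Lambda> i) j)" for r j
    unfolding pmf_bind by (subst integral_measure_pmf_real[of UNIV]) (auto simp: mult.commute)
  have one: "(\<Sum>j\<in>UNIV. pmf r j) = 1" for r :: "'d pmf"
    by (rule sum_pmf_eq_1) auto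
  define v where "v i = pmf p i - pmf q i" for i
  have v: "v j = (\<Sum>i\<in>UNIV. v i * pmf (\<Lambda> i) j)" for j
    using bind[of p j] bind[of q j] by (simp add: v_def p q left_diff_distrib sum_subtractf)
  have v0: "(\<Sum>j\<in>UNIV. v j) = 0" by (simp add: v_def sum_subtractf one)
  have le: "\<bar>v j\<bar> \<le> (\<Sum>i\<in>UNIV. \<bar>v i\<bar> * pmf (\<Lambda> i) j)" for j
    by (subst v) (rule order_trans[OF sum_abs], simp add: abs_mult)
  \<comment> \<open>The absolute value of an invariant vector is subinvariant, and one step
    preserves its total mass; hence it is invariant in every entry.\<close>
  have "(\<Sum>j\<in>UNIV. (\<Sum>i\<in>UNIV. \<bar>v i\<bar> * pmf (\<Lambda> i) j) - \<bar>v j\<bar>) = 0"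
    by (subst sum_subtractf, subst sum.swap) (simp add: sum_distrib_left[symmetric] one)
  then have av: "\<bar>v j\<bar> = (\<Sum>i\<in>UNIV. \<bar>v i\<bar> * pmf (\<Lambda> i) j)" for j
    using le by (subst (asm) sum_nonneg_eq_0_iff) auto
  define S where "S = {i. 0 < v i}"
  have "S = {} \<or> S = UNIV"
  proof (rule irred, rule subsetI)
    fix i j assume i: "i \<in> S" and j: "j \<in> set_pmf (\<Lambda> i)"
    \<comment> \<open>Twice the positive part of \<open>v\<close>, invariant as the sum of two
      invariant vectors.\<close>
    have "0 < (\<bar>v i\<bar> + v i) * pmf (\<Lambda> i) j"
      using i j by (simp add: S_def pmf_positive)
    also have "\<dots> \<le> (\<Sum>i\<in>UNIV. (\<bar>v i\<bar> + v i) * pmf (\<Lambda> i) j)"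
      by (rule member_le_sum) (auto intro!: mult_nonneg_nonneg)
    also have "\<dots> = \<bar>v j\<bar> + v j"
      by (subst av, subst (3) v) (simp add: distrib_right sum.distrib)
    finally show "j \<in> S" by (simp add: S_def)
  qed
  then have "v i \<le> 0" for i
  proof
    assume "S = UNIV"
    then have "0 < (\<Sum>j\<in>UNIV. v j)" by (intro sum_pos) (auto simp: S_def set_eq_iff)
    then show ?thesis using v0 by simp
  qed (auto simp: S_def set_eq_iff not_less)
  then have "\<forall>i\<in>UNIV. - v i = 0"
    using v0 by (subst sum_nonneg_eq_0_iff[symmetric]) (auto simp: sum_negf)
  then show ?thesis by (intro pmf_eqI) (auto simp: v_def)
qed

text \<open>Needed so that both stationary laws, lowered to level \<open>0\<close>, give the same
  start. A closed set of phases lifts to a closed set of states, so irreducibility of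
  \<open>K\<close> suffices; the truncated chain, which never exceeds level \<open>n\<close>, could
  not supply it.\<close>

lemma stationary_phases_eq:
  fixes K K' :: "nat \<times> 'd::finite \<Rightarrow> (nat \<times> 'd) pmf"
  assumes K: "monotone_kernel K" "bind_pmf p K = p" and K': "monotone_kernel K'" "bind_pmf q K' = q"
    and phase: "\<And>x. map_pmf snd (K' x) = map_pmf snd (K x)"
    and irred: "\<And>x y. \<exists>n. y \<in> set_pmf (kernel_pow K n x)"
  shows "map_pmf snd p = map_pmf snd q"
proof (rule finite_stationary_unique)
  let ?\<Lambda> = "\<lambda>i. map_pmf snd (K (0, i))"
  show "bind_pmf (map_pmf snd p) ?\<Lambda> = map_pmf snd p"
    by (rule stationary_phase[OF K])
  show "bind_pmf (map_pmf snd q) ?\<Lambda> = map_pmf snd q"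
    using stationary_phase[OF K'] by (simp only: phase)
  fix S assume S: "\<And>i. i \<in> S \<Longrightarrow> set_pmf (?\<Lambda> i) \<subseteq> S"
  have step: "snd y \<in> S" if "snd x \<in> S" "y \<in> set_pmf (K x)" for x y
  proof -
    have "snd y \<in> set_pmf (map_pmf snd (K (fst x, snd x)))" using that by auto
    then have "snd y \<in> set_pmf (?\<Lambda> (snd x))"
      by (simp only: monotone_kernel_phase[OF K(1), of "fst x" "snd x"])
    then show ?thesis using S[OF that(1)] by blast
  qed
  have closed: "snd y \<in> S" if "snd x \<in> S" "y \<in> set_pmf (kernel_pow K n x)" for n x y
    using that(2)
  proof (induction n arbitrary: y)
    case (Suc n)
    then obtain z where "z \<in> set_pmf (kernel_pow K n x)" "y \<in> set_pmf (K z)" by auto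
    then show ?case using Suc.IH step by blast
  qed (use that in simp)
  show "S = {} \<or> S = UNIV"
  proof (rule disjCI)
    assume "S \<noteq> UNIV"
    show "S = {}"
    proof (rule ccontr)
      assume "S \<noteq> {}"
      then obtain i where "i \<in> S" by auto
      then have "j \<in> S" for j
        using irred[of "(0, j)" "(0, i)"] closed[of "(0, i)" "(0, j)"] by auto
      then show False using \<open>S \<noteq> UNIV\<close> by auto
    qed
  qed
qed

text \<open>Abel summation within each phase: a level-increasing function is a nonnegative
  combination of indicators of upper level sets, with its increments \<open>D l j\<close> as
  weights.\<close>

lemma monotone_kernelI:
  fixes K :: "nat \<times> 'd::finite \<Rightarrow> (nat \<times> 'd) pmf"
  assumes K: "\<And>k l i j. measure_pmf.prob (K (k, i)) {y. l \<le> fst y \<and> snd y = j}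
      \<le> measure_pmf.prob (K (Suc k, i)) {y. l \<le> fst y \<and> snd y = j}"
  shows "monotone_kernel K"
  unfolding monotone_kernel_def
proof (intro allI impI)
  fix g :: "nat \<times> 'd \<Rightarrow> ennreal" assume g: "level_mono g"
  define D where "D l j = (if l = 0 then g (0, j) else g (l, j) - g (l - 1, j))" for l j
  have sumD: "(\<Sum>l<Suc m. D l j) = g (m, j)" for m j
  proof (induction m)
    case (Suc m)
    have "(\<Sum>l<Suc (Suc m). D l j) = g (m, j) + (g (Suc m, j) - g (m, j))"
      unfolding sum.lessThan_Suc[of _ "Suc m"] Suc by (simp add: D_def)
    also have "\<dots> = g (Suc m, j)"
      using level_monoD[OF g, of m "Suc m" j] by (simp add: add.commute diff_add_cancel_ennreal)
    finally show ?case .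
  qed (simp add: D_def)
  have pt: "g y = (\<Sum>j\<in>UNIV. \<Sum>l. D l j * indicator {y. l \<le> fst y \<and> snd y = j} y)" for y
  proof -
    have "(\<Sum>l. D l j * indicator {y. l \<le> fst y \<and> snd y = j} y) = (if j = snd y then g y else 0)" for j
    proof (cases "j = snd y")
      case True
      have "(\<Sum>l. D l j * indicator {y. l \<le> fst y \<and> snd y = j} y)
          = (\<Sum>l<Suc (fst y). D l j * indicator {y. l \<le> fst y \<and> snd y = j} y)"
        by (rule suminf_finite) auto
      also have "\<dots> = (\<Sum>l<Suc (fst y). D l j)"
        using True by (intro sum.cong) auto
      finally show ?thesis using True by (simp only: sumD) simp
    qed simp
    then show ?thesis by simp
  qed
  have int: "(\<integral>\<^sup>+y. g y \<partial>K x) = (\<Sum>j\<in>UNIV. \<Sum>l. D l j * emeasure (K x) {y. l \<le> fst y \<and> snd y = j})" for x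
    by (subst pt, subst nn_integral_sum, simp, subst nn_integral_suminf)
       (simp_all add: nn_integral_cmult)
  have step: "(\<integral>\<^sup>+y. g y \<partial>K (k, i)) \<le> (\<integral>\<^sup>+y. g y \<partial>K (Suc k, i))" for k i
    unfolding int
    by (intro sum_mono suminf_le mult_left_mono)
       (auto simp: measure_pmf.emeasure_eq_measure intro!: ennreal_leI K)
  show "level_mono (\<lambda>x. \<integral>\<^sup>+y. g y \<partial>K x)"
    unfolding level_mono_def
  proof (intro allI impI)
    fix j and k l :: nat assume "k \<le> l"
    then show "(\<integral>\<^sup>+y. g y \<partial>K (k, j)) \<le> (\<integral>\<^sup>+y. g y \<partial>K (l, j))"
      by (rule lift_Suc_mono_le[rotated]) (rule step)
  qed
qed

section \<open>Comparing the two stationary laws\<close>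

text \<open>For \<open>x\<close> drawn from \<open>p\<close>, the starts \<open>x\<close> and
  \<open>(0, snd x)\<close> are compared by \<open>kernel_pow_le_survival\<close>; the former
  reproduces \<open>p\<close> by stationarity.\<close>

lemma level_start_le:
  assumes mono: "monotone_kernel K" and stat: "bind_pmf p K = p"
    and surv: "(\<integral>\<^sup>+x. survival (kernel_pow K M) m x \<partial>p) \<le> ennreal a" and a: "0 \<le> a"
  shows "measure_pmf.prob (bind_pmf (map_pmf (\<lambda>x. (0, snd x)) p) (kernel_pow K (M * m))) S
      \<le> measure_pmf.prob p S + a"
proof (rule measure_le_of_nn_integral_le[OF _ a])
  let ?Q = "kernel_pow K M"
  have "(\<integral>\<^sup>+y. indicator S y \<partial>bind_pmf (map_pmf (\<lambda>x. (0, snd x)) p) (kernel_pow K (M * m)))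
      = (\<integral>\<^sup>+x. \<integral>\<^sup>+y. indicator S y \<partial>kernel_pow ?Q m (0, snd x) \<partial>p)"
    by (simp only: nn_integral_bind_pmf nn_integral_map_pmf kernel_pow_mult)
  also have "\<dots> \<le> (\<integral>\<^sup>+x. (\<integral>\<^sup>+y. indicator S y \<partial>kernel_pow ?Q m (fst x, snd x)) + survival ?Q m (fst x, snd x) \<partial>p)"
    by (intro nn_integral_mono kernel_pow_le_survival monotone_kernel_pow mono) (auto simp: indicator_def)
  also have "\<dots> = (\<integral>\<^sup>+x. \<integral>\<^sup>+y. indicator S y \<partial>kernel_pow ?Q m x \<partial>p) + (\<integral>\<^sup>+x. survival ?Q m x \<partial>p)"
    by (simp only: prod.collapse) (rule nn_integral_add, auto)
  also have "(\<integral>\<^sup>+x. \<integral>\<^sup>+y. indicator S y \<partial>kernel_pow ?Q m x \<partial>p) = (\<integral>\<^sup>+y. indicator S y \<partial>p)"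
    by (simp only: nn_integral_bind_pmf[symmetric] kernel_pow_mult bind_kernel_pow_stationary[OF stat])
  also have "\<dots> + (\<integral>\<^sup>+x. survival ?Q m x \<partial>p) \<le> \<dots> + ennreal a"
    by (intro add_left_mono surv)
  finally show "(\<integral>\<^sup>+y. indicator S y \<partial>bind_pmf (map_pmf (\<lambda>x. (0, snd x)) p) (kernel_pow K (M * m)))
      \<le> (\<integral>\<^sup>+y. indicator S y \<partial>p) + ennreal a" .
qed

text \<open>Four laws form a chain: \<open>q\<close>, then \<open>K'\<close> and \<open>K\<close>
  run from the common start at level \<open>0\<close>, then \<open>p\<close>. Each outer link costs
  \<open>a\<close>, the middle one \<open>M * m * e\<close>, and passing from sets to the l1
  distance doubles the sum.\<close>

lemma stationary_l1_bound:
  fixes K K' :: "nat \<times> 'd \<Rightarrow> (nat \<times> 'd) pmf"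
  assumes K: "monotone_kernel K" "bind_pmf p K = p" and K': "monotone_kernel K'" "bind_pmf q K' = q"
    and phase: "map_pmf snd p = map_pmf snd q"
    and surv: "(\<integral>\<^sup>+x. survival (kernel_pow K M) m x \<partial>p) \<le> ennreal a"
    and surv': "(\<integral>\<^sup>+x. survival (kernel_pow K' M) m x \<partial>q) \<le> ennreal a"
    and err: "\<And>g x. (\<And>y. g y \<le> 1) \<Longrightarrow> (\<integral>\<^sup>+y. g y \<partial>K' x) \<le> (\<integral>\<^sup>+y. g y \<partial>K x) + err x"
    and err_mono: "level_mono err" and err_q: "(\<integral>\<^sup>+x. err x \<partial>q) \<le> ennreal e"
    and nonneg: "0 \<le> a" "0 \<le> e"
  shows "l1_dist (pmf q) (pmf p) \<le> 4 * a + 2 * real m * real M * e"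
proof -
  let ?\<mu> = "map_pmf (\<lambda>x. (0, snd x)) p" and ?n = "M * m"
  have \<mu>: "?\<mu> = map_pmf (\<lambda>x. (0, snd x)) q"
    using arg_cong[OF phase, of "map_pmf (Pair 0)"] by (simp add: map_pmf_comp)
  have trunc: "measure_pmf.prob (bind_pmf ?\<mu> (kernel_pow K' ?n)) S
      \<le> measure_pmf.prob (bind_pmf ?\<mu> (kernel_pow K ?n)) S + real ?n * e" for S
  proof (rule measure_le_of_nn_integral_le)
    \<comment> \<open>The errors are met by the \<open>K'\<close> chain started at level
      \<open>0\<close>. As \<open>err\<close> is level-increasing, raising the start to the
      stationary law \<open>q\<close> only increases their mean, which is then the same at all
      times.\<close>
    have l: "(\<integral>\<^sup>+x. \<integral>\<^sup>+y. err y \<partial>kernel_pow K' l x \<partial>?\<mu>) \<le> ennreal e" for l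
    proof -
      have "(\<integral>\<^sup>+x. \<integral>\<^sup>+y. err y \<partial>kernel_pow K' l x \<partial>?\<mu>)
          = (\<integral>\<^sup>+x. \<integral>\<^sup>+y. err y \<partial>kernel_pow K' l (0, snd x) \<partial>q)"
        unfolding \<mu> by simp
      also have "\<dots> \<le> (\<integral>\<^sup>+x. \<integral>\<^sup>+y. err y \<partial>kernel_pow K' l (fst x, snd x) \<partial>q)"
        by (intro nn_integral_mono level_monoD[OF monotone_kernelD[OF monotone_kernel_pow[OF K'(1)] err_mono]]) simp
      also have "\<dots> = (\<integral>\<^sup>+y. err y \<partial>q)"
        by (simp only: prod.collapse nn_integral_bind_pmf[symmetric] bind_kernel_pow_stationary[OF K'(2)])
      also have "\<dots> \<le> ennreal e" by (rule err_q)
      finally show ?thesis .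
    qed
    have "(\<integral>\<^sup>+y. indicator S y \<partial>bind_pmf ?\<mu> (kernel_pow K' ?n))
        = (\<integral>\<^sup>+x. \<integral>\<^sup>+y. indicator S y \<partial>kernel_pow K' ?n x \<partial>?\<mu>)"
      by (simp only: nn_integral_bind_pmf)
    also have "\<dots> \<le> (\<integral>\<^sup>+x. (\<integral>\<^sup>+y. indicator S y \<partial>kernel_pow K ?n x)
        + (\<Sum>l<?n. \<integral>\<^sup>+y. err y \<partial>kernel_pow K' l x) \<partial>?\<mu>)"
      by (intro nn_integral_mono kernel_pow_perturbation err) (auto simp: indicator_def)
    also have "\<dots> = (\<integral>\<^sup>+x. \<integral>\<^sup>+y. indicator S y \<partial>kernel_pow K ?n x \<partial>?\<mu>)
        + (\<Sum>l<?n. \<integral>\<^sup>+x. \<integral>\<^sup>+y. err y \<partial>kernel_pow K' l x \<partial>?\<mu>)"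
      by (subst nn_integral_add, simp, simp, subst nn_integral_sum) (simp, rule refl)
    also have "\<dots> \<le> (\<integral>\<^sup>+x. \<integral>\<^sup>+y. indicator S y \<partial>kernel_pow K ?n x \<partial>?\<mu>) + (\<Sum>l<?n. ennreal e)"
      by (intro add_left_mono sum_mono l)
    also have "\<dots> = (\<integral>\<^sup>+y. indicator S y \<partial>bind_pmf ?\<mu> (kernel_pow K ?n)) + ennreal (real ?n * e)"
      using nonneg by (simp add: ennreal_mult' ennreal_of_nat_eq_real_of_nat)
    finally show "(\<integral>\<^sup>+y. indicator S y \<partial>bind_pmf ?\<mu> (kernel_pow K' ?n))
        \<le> (\<integral>\<^sup>+y. indicator S y \<partial>bind_pmf ?\<mu> (kernel_pow K ?n)) + ennreal (real ?n * e)" .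
  qed (use nonneg in simp)
  have "l1_dist (pmf q) (pmf p) \<le> 2 * (a + real ?n * e + a)"
  proof (rule l1_dist_le_of_measure_le)
    fix S
    have "measure_pmf.prob q S \<le> measure_pmf.prob (bind_pmf ?\<mu> (kernel_pow K' ?n)) S + a"
      unfolding \<mu> by (rule measure_le_compl[OF level_start_le[OF K' surv' nonneg(1)]])
    also have "measure_pmf.prob (bind_pmf ?\<mu> (kernel_pow K' ?n)) S
        \<le> measure_pmf.prob (bind_pmf ?\<mu> (kernel_pow K ?n)) S + real ?n * e"
      by (rule trunc)
    also have "measure_pmf.prob (bind_pmf ?\<mu> (kernel_pow K ?n)) S \<le> measure_pmf.prob p S + a"
      by (rule level_start_le[OF K surv nonneg(1)])
    finally show "measure_pmf.prob q S \<le> measure_pmf.prob p S + (a + real ?n * e + a)" by simp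
  qed
  then show ?thesis by (simp add: algebra_simps)
qed

section \<open>Kernels of GI/G/1 type\<close>

lemma has_sum_pmf_bind:
  "((\<lambda>z. pmf p z * pmf (k z) y) has_sum pmf (bind_pmf p k) y) UNIV"
proof (rule has_sum_nn_integral_count_space)
  show "(\<integral>\<^sup>+z. ennreal (pmf p z * pmf (k z) y) \<partial>count_space UNIV) = ennreal (pmf (bind_pmf p k) y)"
    unfolding ennreal_pmf_bind nn_integral_measure_pmf by (simp add: ennreal_mult)
qed auto

lemma has_sum_Times_finite:
  fixes f :: "'a \<times> 'd::finite \<Rightarrow> real"
  assumes "(f has_sum s) UNIV"
  shows "((\<lambda>x. \<Sum>j\<in>UNIV. f (x, j)) has_sum s) UNIV"
proof -
  have "(f has_sum s) (Sigma UNIV (\<lambda>_. UNIV))" using assms by simp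
  then show ?thesis
    by (rule has_sum_SigmaD) (auto intro: has_sum_finite)
qed

lemma nn_integral_level:
  fixes p :: "(nat \<times> 'd::finite) pmf"
  shows "(\<integral>\<^sup>+y. g (fst y) \<partial>p) = (\<integral>\<^sup>+l. ennreal (\<Sum>j\<in>UNIV. pmf p (l, j)) * g l \<partial>count_space UNIV)"
proof -
  have "pmf (map_pmf fst p) l = (\<Sum>j\<in>UNIV. pmf p (l, j))" for l
  proof -
    have "fst -` {l} = Pair l ` (UNIV :: 'd set)" by auto
    then have "pmf (map_pmf fst p) l = sum (pmf p) (Pair l ` UNIV)"
      unfolding pmf_map by (simp only:) (rule measure_measure_pmf_finite, simp)
    also have "\<dots> = (\<Sum>j\<in>UNIV. pmf p (l, j))"
      by (subst sum.reindex) (auto simp: inj_on_def)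
    finally show ?thesis .
  qed
  then show ?thesis
    using nn_integral_measure_pmf[of "map_pmf fst p" g] by simp
qed

lemma block_monotone_kernel:
  fixes K :: "nat \<times> 'd::finite \<Rightarrow> (nat \<times> 'd) pmf"
  assumes K: "\<And>x y. pmf (K x) y = P x y" and P: "block_monotone P"
  shows "measure_pmf.prob (K (k, i)) {y. l \<le> fst y \<and> snd y = j}
      \<le> measure_pmf.prob (K (Suc k, i)) {y. l \<le> fst y \<and> snd y = j}"
proof -
  have h: "((\<lambda>m. blk P k m $ i $ j) has_sum measure_pmf.prob (K (k, i)) {y. l \<le> fst y \<and> snd y = j}) {l..}"
    for k i j
  proof -
    have "{y. l \<le> fst y \<and> snd y = j} = (\<lambda>m. (m, j)) ` {l..}" by auto
    then have "(pmf (K (k, i)) has_sum measure_pmf.prob (K (k, i)) {y. l \<le> fst y \<and> snd y = j}) ((\<lambda>m. (m, j)) ` {l..})"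
      using has_sum_pmf[of "K (k, i)"] by metis
    then show ?thesis
      by (subst (asm) has_sum_reindex) (auto simp: inj_on_def o_def K blk_def)
  qed
  have "(\<Sum>\<^sub>\<infinity>m\<in>{l..}. blk P k m) $ i $ j = measure_pmf.prob (K (k, i)) {y. l \<le> fst y \<and> snd y = j}" for k i j
  proof -
    have "(\<Sum>\<^sub>\<infinity>m\<in>{l..}. blk P k m) $ i $ j = (\<Sum>\<^sub>\<infinity>m\<in>{l..}. blk P k m $ i $ j)"
      using h by (intro infsum_matrix_nth(2)) (auto simp: summable_on_def)
    then show ?thesis using infsumI[OF h] by simp
  qed
  moreover have "(\<Sum>\<^sub>\<infinity>m\<in>{l..}. blk P k m) $ i $ j \<le> (\<Sum>\<^sub>\<infinity>m\<in>{l..}. blk P (Suc k) m) $ i $ j"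
    using P by (simp add: block_monotone_def less_eq_vec_def)
  ultimately show ?thesis by simp
qed

text \<open>The truncated chain is the image of a step of the original one under capping the level
  at \<open>n\<close>: the augmented block collects the preimage of level \<open>n\<close>.
  Domination and perturbation then become pointwise statements.\<close>

lemma lc_trunc_kernel:
  fixes K :: "nat \<times> 'd::finite \<Rightarrow> (nat \<times> 'd) pmf"
  assumes K: "\<And>x y. pmf (K x) y = P x y"
  shows "pmf (map_pmf (map_prod (min n) id) (K x)) y = lc_trunc n P x y"
proof -
  obtain k i where x: "x = (k, i)" by (cases x)
  obtain l j where y: "y = (l, j)" by (cases y)
  have h: "((\<lambda>m. blk P k m $ i $ j) has_sum measure_pmf.prob (K (k, i)) ((\<lambda>m. (m, j)) ` {n..})) {n..}" for i j
    using has_sum_pmf[of "K (k, i)" "(\<lambda>m. (m, j)) ` {n..}"]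
    by (subst (asm) has_sum_reindex) (auto simp: inj_on_def o_def K blk_def)
  consider "l < n" | "l = n" | "n < l" by linarith
  then show ?thesis
  proof cases
    case 1
    then have "map_prod (min n) id -` {y} = {y}" by (auto simp: y min_def split: if_splits)
    with 1 show ?thesis
      by (simp add: pmf_map measure_pmf_single K x y lc_trunc_def of_blocks_def blk_def)
  next
    case 2
    then have "map_prod (min n) id -` {y} = (\<lambda>m. (m, j)) ` {n..}" by (auto simp: y min_def split: if_splits)
    moreover have "(\<Sum>\<^sub>\<infinity>m\<in>{n..}. blk P k m) $ i $ j = (\<Sum>\<^sub>\<infinity>m\<in>{n..}. blk P k m $ i $ j)"
      using h by (intro infsum_matrix_nth(2)) (auto simp: summable_on_def)
    ultimately show ?thesis
      using 2 infsumI[OF h] by (simp add: pmf_map x y lc_trunc_def of_blocks_def)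
  next
    case 3
    then have "map_prod (min n) id -` {y} = {}" by (auto simp: y min_def split: if_splits)
    with 3 show ?thesis by (simp add: pmf_map x y lc_trunc_def of_blocks_def)
  qed
qed

text \<open>A divergent series would have the default value \<open>0\<close>, contradicting row sums
  equal to \<open>1\<close>.\<close>

lemma summable_of_stochastic_sum:
  fixes A :: "int \<Rightarrow> real^'d::finite^'d"
  assumes "stochastic_mat (\<lambda>i j. (\<Sum>\<^sub>\<infinity>k. A k) $ i $ j)"
  shows "A summable_on S"
proof -
  have "A summable_on UNIV"
  proof (rule ccontr)
    assume "\<not> A summable_on UNIV"
    then have "((\<lambda>j. (0::real)) has_sum 1) (UNIV :: 'd set)"
      using assms by (simp add: stochastic_mat_def infsum_not_exists)
    then show False using has_sum_unique[OF _ has_sum_0] by fastforce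
  qed
  then show ?thesis by (rule summable_on_subset_banach) simp
qed

lemma lower_sum_split:
  assumes A: "\<And>S. A summable_on S" and "k \<le> N"
  shows "lower_sum A k = lower_sum A N + (\<Sum>l\<in>{- int N + 1..- int k}. A l)"
proof -
  have "{..- int k} = {..- int N} \<union> {- int N + 1..- int k}" using assms(2) by auto
  then show ?thesis
    unfolding lower_sum_def by (simp only:) (subst infsum_Un_disjoint, auto intro: A)
qed

lemma lower_sum_trunc_A:
  assumes A: "\<And>S. A summable_on S" and "0 < N"
  shows "lower_sum (trunc_A N A) k = (if k \<le> N then lower_sum A k else 0)"
proof (cases "k \<le> N")
  case True
  have "lower_sum (trunc_A N A) k = infsum (trunc_A N A) {- int N..- int k}"
    unfolding lower_sum_def by (rule infsum_cong_neutral) (auto simp: trunc_A_def)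
  also have "\<dots> = trunc_A N A (- int N) + (\<Sum>l\<in>{- int N + 1..- int k}. trunc_A N A l)"
  proof -
    have "{- int N..- int k} = insert (- int N) {- int N + 1..- int k}" using True by auto
    then show ?thesis by simp
  qed
  also have "(\<Sum>l\<in>{- int N + 1..- int k}. trunc_A N A l) = (\<Sum>l\<in>{- int N + 1..- int k}. A l)"
    by (intro sum.cong) (auto simp: trunc_A_def)
  also have "trunc_A N A (- int N) = lower_sum A N" by (simp add: trunc_A_def)
  finally show ?thesis using True lower_sum_split[OF A True] by simp
next
  case False
  have "lower_sum (trunc_A N A) k = infsum (\<lambda>_. 0) {..- int k}"
    unfolding lower_sum_def using False by (intro infsum_cong) (auto simp: trunc_A_def)
  then show ?thesis using False by simp
qed

text \<open>Truncating the downward jumps of the chain at \<open>N\<close> lifts the target level.\<close>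

lemma GIG1_trunc_kernel:
  fixes K :: "nat \<times> 'd::finite \<Rightarrow> (nat \<times> 'd) pmf"
  assumes K: "\<And>x y. pmf (K x) y = GIG1 A B x y"
    and A: "\<And>S. A summable_on S" and N: "0 < N"
  shows "pmf (map_pmf (map_prod (max (fst x - N)) id) (K x)) y = GIG1 (trunc_A N A) B x y"
proof -
  obtain k i where x: "x = (k, i)" by (cases x)
  obtain l j where y: "y = (l, j)" by (cases y)
  have pmf: "pmf (map_pmf (map_prod (max (fst x - N)) id) (K x)) y
      = measure_pmf.prob (K x) {z. max (k - N) (fst z) = l \<and> snd z = j}"
    unfolding pmf_map by (rule arg_cong[where f = "measure_pmf.prob (K x)"]) (auto simp: x y)
  \<comment> \<open>Natural subtraction makes the lift trivial for \<open>k \<le> N\<close>.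
    Otherwise all mass on levels up to \<open>k - N\<close> is collected at \<open>k - N\<close>,
    and its total, boundary block included, is \<open>lower_sum A N\<close>.\<close>
  consider "k \<le> N \<or> k - N < l" | "N < k" "l < k - N" | "N < k" "l = k - N" by linarith
  then show ?thesis
  proof cases
    case 1
    then have "{z. max (k - N) (fst z) = l \<and> snd z = j} = {y}" by (auto simp: y max_def split: if_splits)
    then have "pmf (map_pmf (map_prod (max (fst x - N)) id) (K x)) y = GIG1 A B x y"
      unfolding pmf by (simp add: measure_pmf_single K)
    also have "\<dots> = GIG1 (trunc_A N A) B x y"
      using 1 N by (auto simp: GIG1_def of_blocks_def x y lower_sum_trunc_A[OF A N] trunc_A_def)
    finally show ?thesis .
  next
    case 2
    then have e: "{z. max (k - N) (fst z) = l \<and> snd z = j} = {}" by (auto simp: max_def split: if_splits)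
    show ?thesis
      unfolding pmf e using 2 by (auto simp: GIG1_def of_blocks_def x y lower_sum_trunc_A[OF A N] trunc_A_def)
  next
    case 3
    have "{z. max (k - N) (fst z) = l \<and> snd z = j} = (\<lambda>m. (m, j)) ` {..k - N}"
      using 3 by (auto simp: max_def split: if_splits)
    then have "measure_pmf.prob (K x) {z. max (k - N) (fst z) = l \<and> snd z = j}
        = sum (pmf (K x)) ((\<lambda>m. (m, j)) ` {..k - N})"
      by (simp only:) (rule measure_measure_pmf_finite, simp)
    also have "\<dots> = (\<Sum>m\<le>k - N. GIG1 A B x (m, j))"
      by (subst sum.reindex) (auto simp: inj_on_def K)
    also have "\<dots> = lower_sum A k $ i $ j + (\<Sum>m\<in>{1..k - N}. A (int m - int k) $ i $ j)"
    proof -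
      have "{..k - N} = insert 0 {1..k - N}" by auto
      then show ?thesis using 3 by (simp add: GIG1_def of_blocks_def x)
    qed
    also have "(\<Sum>m\<in>{1..k - N}. A (int m - int k) $ i $ j) = (\<Sum>l\<in>{- int k + 1..- int N}. A l $ i $ j)"
      using 3 by (intro sum.reindex_bij_witness[of _ "\<lambda>l. nat (l + int k)" "\<lambda>m. int m - int k"]) auto
    also have "lower_sum A k $ i $ j + \<dots> = lower_sum A N $ i $ j"
      using 3 lower_sum_split[OF A, of N k] by (simp add: sum_component)
    also have "\<dots> = GIG1 (trunc_A N A) B x y"
      using 3 by (simp add: GIG1_def of_blocks_def x y trunc_A_def)
    finally show ?thesis unfolding pmf .
  qed
qed

lemma conv_pow_trunc_A_eq_0:
  "m < - int (n * N) \<Longrightarrow> conv_pow (trunc_A N A) n m = 0"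
proof (induction n arbitrary: m)
  case (Suc n)
  have "conv_pow (trunc_A N A) n (m - l) ** trunc_A N A l = 0" for l
  proof (cases "l < - int N")
    case False
    then have "m - l < - int (n * N)" using Suc.prems by (simp add: algebra_simps)
    then show ?thesis by (simp add: Suc.IH)
  qed (simp add: trunc_A_def)
  then show ?case by simp
qed simp

text \<open>Above level \<open>n N\<close> the boundary is not felt within \<open>n\<close> steps.\<close>

lemma kernel_pow_eq_conv_pow:
  fixes K :: "nat \<times> 'd::finite \<Rightarrow> (nat \<times> 'd) pmf"
  assumes K: "\<And>x y. pmf (K x) y = GIG1 (trunc_A N A) B x y"
    and A: "\<And>S. A summable_on S" and N: "0 < N"
  shows "n * N < k \<Longrightarrow>
    pmf (kernel_pow K n (k, i)) (l, j) = conv_pow (trunc_A N A) n (int l - int k) $ i $ j"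
proof (induction n arbitrary: l i j)
  case 0
  then show ?case by (auto simp: mat_def indicator_def)
next
  case (Suc n)
  define f where "f l' = conv_pow (trunc_A N A) n (int l - int k - l') ** trunc_A N A l'" for l'
  have "((\<lambda>l'. f l' $ i $ j) has_sum pmf (kernel_pow K (Suc n) (k, i)) (l, j)) UNIV" for i j
  proof -
    have "((\<lambda>h. \<Sum>p\<in>UNIV. pmf (kernel_pow K n (k, i)) (h, p) * pmf (K (h, p)) (l, j)) has_sum
        pmf (kernel_pow K (Suc n) (k, i)) (l, j)) UNIV"
      using has_sum_Times_finite[OF has_sum_pmf_bind[of "kernel_pow K n (k, i)" K "(l, j)"]] by simp
    moreover have "(\<Sum>p\<in>UNIV. pmf (kernel_pow K n (k, i)) (h, p) * pmf (K (h, p)) (l, j))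
        = f (int l - int h) $ i $ j" for h
    proof (cases "int h - int k < - int (n * N)")
      case True
      then show ?thesis
        using Suc by (simp add: f_def conv_pow_trunc_A_eq_0)
    next
      case False
      moreover have "n * N + N < k" using Suc.prems by simp
      \<comment> \<open>After \<open>n\<close> steps the level still exceeds \<open>N\<close>. There
        the boundary block is zero, and so is \<open>trunc_A N A (- int h)\<close>, so that the
        interior formula also holds for \<open>l = 0\<close>.\<close>
      ultimately have h: "N < h" by linarith
      then have "pmf (K (h, p)) (l, j) = trunc_A N A (int l - int h) $ p $ j" for p
        using N by (auto simp: K GIG1_def of_blocks_def lower_sum_trunc_A[OF A N]) (simp add: trunc_A_def)
      then show ?thesis
        using Suc by (simp add: f_def matrix_matrix_mult_def)
    qed
    ultimately have "((\<lambda>h::nat. f (int l - int h) $ i $ j) has_sum pmf (kernel_pow K (Suc n) (k, i)) (l, j)) UNIV"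
      by simp
    then have "((\<lambda>l'. f l' $ i $ j) has_sum pmf (kernel_pow K (Suc n) (k, i)) (l, j)) (range (\<lambda>h::nat. int l - int h))"
      by (subst has_sum_reindex) (auto simp: inj_on_def o_def)
    \<comment> \<open>The convolution runs over all integers, the chain only over natural levels
      \<open>h = l - l'\<close>; a negative \<open>h\<close> would require a fall by more than
      \<open>n * N\<close> in \<open>n\<close> steps.\<close>
    moreover have "f l' = 0" if "l' \<notin> range (\<lambda>h::nat. int l - int h)" for l'
    proof -
      have "int l < l'"
      proof (rule ccontr)
        assume "\<not> int l < l'"
        then have "l' = int l - int (nat (int l - l'))" by simp
        with that show False by blast
      qed
      moreover have "n * N < k" using Suc.prems by simp
      ultimately have "int l - int k - l' < - int (n * N)" by linarith
      then show ?thesis by (simp add: f_def conv_pow_trunc_A_eq_0)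
    qed
    ultimately show ?thesis
      by (subst has_sum_cong_neutral[where T = "range (\<lambda>h::nat. int l - int h)" and g = "\<lambda>l'. f l' $ i $ j"]) auto
  qed
  then have "(f has_sum (\<chi> i j. pmf (kernel_pow K (Suc n) (k, i)) (l, j))) UNIV"
    by (simp add: has_sum_vec_iff)
  then have "conv_pow (trunc_A N A) (Suc n) (int l - int k) = (\<chi> i j. pmf (kernel_pow K (Suc n) (k, i)) (l, j))"
    unfolding conv_pow.simps f_def[symmetric] by (rule infsumI)
  then show ?case by simp
qed

section \<open>Level truncation and drift\<close>

lemma level_mono_fst:
  "(\<And>k l. k \<le> l \<Longrightarrow> g k \<le> g l) \<Longrightarrow> level_mono (\<lambda>x. ennreal (g (fst x)))"
  by (auto simp: level_mono_def intro: ennreal_leI)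

lemma monotone_kernel_level_trunc:
  assumes "monotone_kernel K"
  shows "monotone_kernel (\<lambda>x. map_pmf (map_prod (min n) id) (K x))"
  unfolding monotone_kernel_def
proof (intro allI impI)
  fix g :: "nat \<times> 'a \<Rightarrow> ennreal" assume "level_mono g"
  then have "level_mono (\<lambda>y. g (map_prod (min n) id y))"
    by (auto simp: level_mono_def)
  from monotone_kernelD[OF assms this]
  show "level_mono (\<lambda>x. \<integral>\<^sup>+y. g y \<partial>map_pmf (map_prod (min n) id) (K x))" by simp
qed

lemma dominated_kernel_level_trunc:
  "dominated_kernel (\<lambda>x. map_pmf (map_prod (min n) id) (K x)) K"
  unfolding dominated_kernel_def
  by (auto simp: level_mono_def map_prod_def split_beta intro!: nn_integral_mono)

lemma dominated_kernel_level_lift: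
  "dominated_kernel K (\<lambda>x. map_pmf (map_prod (max (f x)) id) (K x))"
  unfolding dominated_kernel_def
  by (auto simp: level_mono_def map_prod_def split_beta intro!: nn_integral_mono)

text \<open>Capping alters only landings above \<open>n\<close>, and there \<open>g \<le> 1\<close>
  is the cost.\<close>

lemma level_trunc_perturbation:
  assumes g: "\<And>y. g y \<le> 1"
  shows "(\<integral>\<^sup>+y. g y \<partial>map_pmf (map_prod (min n) id) (k :: (nat \<times> 'd) pmf))
      \<le> (\<integral>\<^sup>+y. g y \<partial>k) + emeasure k {y. n < fst y}"
proof -
  have "(\<integral>\<^sup>+y. g y \<partial>map_pmf (map_prod (min n) id) k) \<le> (\<integral>\<^sup>+y. g y + indicator {y. n < fst y} y \<partial>k)"
    unfolding nn_integral_map_pmf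
  proof (rule nn_integral_mono)
    fix y :: "nat \<times> 'd"
    show "g (map_prod (min n) id y) \<le> g y + indicator {y. n < fst y} y"
    proof (cases "n < fst y")
      case True
      then show ?thesis using g[of "map_prod (min n) id y"] by (simp add: add_increasing)
    next
      case False
      then have "map_prod (min n) id y = y" by (cases y) (auto simp: min_def)
      then show ?thesis by simp
    qed
  qed
  also have "\<dots> = (\<integral>\<^sup>+y. g y \<partial>k) + emeasure k {y. n < fst y}"
    by (simp add: nn_integral_add)
  finally show ?thesis .
qed

text \<open>A landing above \<open>n\<close> is a landing at \<open>n\<close> for the truncated
  chain, and by stationarity \<open>q\<close> is also the law after that step.\<close>

lemma level_trunc_error_stationary:
  fixes K :: "nat \<times> 'd \<Rightarrow> (nat \<times> 'd) pmf"
  assumes "bind_pmf q (\<lambda>x. map_pmf (map_prod (min n) id) (K x)) = q"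
  shows "(\<integral>\<^sup>+x. emeasure (K x) {y. n < fst y} \<partial>q) \<le> emeasure q {y. fst y = n}"
proof -
  have "(\<integral>\<^sup>+x. emeasure (K x) {y. n < fst y} \<partial>q)
      \<le> (\<integral>\<^sup>+x. emeasure (map_pmf (map_prod (min n) id) (K x)) {y. fst y = n} \<partial>q)"
    by (intro nn_integral_mono) (auto intro!: emeasure_mono min_absorb1)
  also have "\<dots> = emeasure (bind_pmf q (\<lambda>x. map_pmf (map_prod (min n) id) (K x))) {y. fst y = n}"
    by simp
  finally show ?thesis by (simp only: assms)
qed

context drift_function
begin

text \<open>Far from the boundary the increments of the chain are distributed according to \<open>c\<close>.\<close>

lemma drift_above:
  fixes p :: "(nat \<times> 'd::finite) pmf" and c :: "int \<Rightarrow> real" and k L :: nat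
  assumes pc: "\<And>l. (\<Sum>j\<in>UNIV. pmf p (l, j)) = c (int l - int k)"
    and c_nonneg: "\<And>m. 0 \<le> c m" and c_0: "\<And>m. m < - int L \<Longrightarrow> c m = 0" and L: "L < k"
    and summable: "(\<lambda>m. of_int m * c m) summable_on {- int L..}"
    and \<epsilon>: "0 < \<epsilon>" and D: "0 \<le> D" and \<kappa>: "0 < \<kappa>"
    and mean: "(1 - \<epsilon>) * (\<Sum>\<^sub>\<infinity>m\<in>{- int L..}. of_int m * c m)
        + 2 * \<epsilon> * (\<Sum>\<^sub>\<infinity>m\<in>{0..}. of_int m * c m) \<le> - 2 * \<kappa>"
    and up: "V' (real k + D) \<le> (1 + \<epsilon>) * V' (real k)"
    and down: "(1 - \<epsilon>) * V' (real k) \<le> V' (real k - real L)"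
    and tail: "(\<Sum>\<^sub>\<infinity>m\<in>{\<lfloor>D\<rfloor> + 1..}. ennreal (V (real k + of_int m) * c m)) \<le> ennreal (\<kappa> * V' (real k))"
  shows "(\<integral>\<^sup>+y. ennreal (V (real (fst y))) \<partial>p) + ennreal (\<kappa> * V' (real k)) \<le> ennreal (V (real k))"
proof -
  \<comment> \<open>Jumps up to \<open>F\<close> are handled by the slopes of \<open>V\<close>,
    larger ones by the tail assumption.\<close>
  define F where "F = \<lfloor>D\<rfloor>"
  have F: "0 \<le> F" "of_int F \<le> D" using D by (auto simp: F_def)
  have int: "(\<integral>\<^sup>+y. g (fst y) \<partial>p) = (\<Sum>\<^sub>\<infinity>m\<in>{- int L..}. ennreal (c m) * g (nat (int k + m)))"
    for g :: "nat \<Rightarrow> ennreal"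
  proof -
    have bij: "bij_betw (\<lambda>l. int l - int k) UNIV {- int k..}"
      by (rule bij_betw_byWitness[where f' = "\<lambda>m. nat (int k + m)"]) auto
    have "(\<integral>\<^sup>+y. g (fst y) \<partial>p) = (\<integral>\<^sup>+l. ennreal (c (int l - int k)) * g (nat (int k + (int l - int k))) \<partial>count_space UNIV)"
      unfolding nn_integral_level pc by simp
    also have "\<dots> = (\<integral>\<^sup>+m. ennreal (c m) * g (nat (int k + m)) \<partial>count_space {- int k..})"
      by (rule nn_integral_bij_count_space[OF bij])
    also have "\<dots> = (\<integral>\<^sup>+m. ennreal (c m) * g (nat (int k + m)) \<partial>count_space {- int L..})"
      using L by (intro nn_integral_count_space_eq) (auto simp: c_0)
    finally show ?thesis by (simp only: infsum_ennreal_eq_nn_integral_count_space)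
  qed
  have split: "{- int L..} = {- int L..F} \<union> {F + 1..}" using F by auto
  have V_nonneg: "0 \<le> V (real k + of_int m)" if "- int L \<le> m" for m
    using V_ge_1[of "real k + of_int m"] that L by linarith
  have total: "(\<Sum>m\<in>{- int L..F}. c m) \<le> 1"
  proof -
    have "ennreal (\<Sum>m\<in>{- int L..F}. c m) = (\<Sum>m\<in>{- int L..F}. ennreal (c m))"
      by (simp add: c_nonneg)
    also have "\<dots> \<le> (\<Sum>\<^sub>\<infinity>m\<in>{- int L..}. ennreal (c m))"
      by (subst nonneg_infsum_complete) (auto intro!: SUP_upper)
    also have "\<dots> = 1"
      using int[of "\<lambda>_. 1"] by simp
    finally show ?thesis by simp
  qed
  define Sp where "Sp = (\<Sum>\<^sub>\<infinity>m\<in>{0..}. of_int m * c m)"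
  define Sm where "Sm = (\<Sum>m\<in>{- int L..-1}. of_int m * c m)"
  have summable0: "(\<lambda>m. of_int m * c m) summable_on {0..}"
    by (rule summable_on_subset_banach[OF summable]) auto
  have S: "(\<Sum>\<^sub>\<infinity>m\<in>{- int L..}. of_int m * c m) = Sm + Sp"
  proof -
    have "{- int L..} = {- int L..-1} \<union> {0..}" by auto
    then show ?thesis
      unfolding Sm_def Sp_def by (simp only:) (subst infsum_Un_disjoint, auto intro: summable0)
  qed
  have Sp_ge: "(\<Sum>m\<in>{0..F}. of_int m * c m) \<le> Sp"
    unfolding Sp_def by (intro finite_sum_le_infsum summable0) (auto simp: c_nonneg)
  have le_up: "V (real k + of_int m) \<le> V (real k) + (1 + \<epsilon>) * V' (real k) * of_int m" if "0 \<le> m" "m \<le> F" for m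
  proof -
    have mD: "of_int m \<le> D" using that F by linarith
    have "V (real k + of_int m) - V (real k) \<le> V' (real k + of_int m) * of_int m"
      using V_diff_bounds(2)[of "real k" "real k + of_int m"] that by simp
    also have "\<dots> \<le> (1 + \<epsilon>) * V' (real k) * of_int m"
    proof (rule mult_right_mono)
      have "V' (real k + of_int m) \<le> V' (real k + D)" using mD that by (intro V'_mono) auto
      then show "V' (real k + of_int m) \<le> (1 + \<epsilon>) * V' (real k)" using up by simp
    qed (use that in simp)
    finally show ?thesis by simp
  qed
  have le_down: "V (real k + of_int m) \<le> V (real k) + (1 - \<epsilon>) * V' (real k) * of_int m"
    if "- int L \<le> m" "m \<le> 0" for m
  proof -
    have kL: "0 \<le> real k - real L" "real k - real L \<le> real k + of_int m" using that L by linarith+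
    have "(1 - \<epsilon>) * V' (real k) * (- of_int m) \<le> V' (real k + of_int m) * (- of_int m)"
    proof (rule mult_right_mono)
      show "(1 - \<epsilon>) * V' (real k) \<le> V' (real k + of_int m)"
        using down V'_mono[OF kL] by simp
    qed (use that in simp)
    also have "\<dots> \<le> V (real k) - V (real k + of_int m)"
      using V_diff_bounds(1)[of "real k + of_int m" "real k"] that kL by simp
    finally show ?thesis by simp
  qed
  define X where "X = (\<Sum>m\<in>{- int L..F}. V (real k + of_int m) * c m)"
  have X_nonneg: "0 \<le> X"
    unfolding X_def by (intro sum_nonneg mult_nonneg_nonneg V_nonneg c_nonneg) auto
  have lists: "{- int L..F} = {- int L..-1} \<union> {0..F}" using F by auto
  have "X = (\<Sum>m\<in>{- int L..-1}. V (real k + of_int m) * c m) + (\<Sum>m\<in>{0..F}. V (real k + of_int m) * c m)"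
    unfolding X_def lists by (rule sum.union_disjoint) auto
  also have "\<dots> \<le> (\<Sum>m\<in>{- int L..-1}. (V (real k) + (1 - \<epsilon>) * V' (real k) * of_int m) * c m)
      + (\<Sum>m\<in>{0..F}. (V (real k) + (1 + \<epsilon>) * V' (real k) * of_int m) * c m)"
    by (intro add_mono sum_mono mult_right_mono le_up le_down c_nonneg) auto
  also have "\<dots> = V (real k) * ((\<Sum>m\<in>{- int L..-1}. c m) + (\<Sum>m\<in>{0..F}. c m))
      + V' (real k) * ((1 - \<epsilon>) * Sm + (1 + \<epsilon>) * (\<Sum>m\<in>{0..F}. of_int m * c m))"
    unfolding Sm_def by (simp add: sum_distrib_left distrib_left distrib_right sum.distrib mult_ac)
  also have "(\<Sum>m\<in>{- int L..-1}. c m) + (\<Sum>m\<in>{0..F}. c m) = (\<Sum>m\<in>{- int L..F}. c m)"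
    unfolding lists by (rule sum.union_disjoint[symmetric]) auto
  also have "V (real k) * (\<Sum>m\<in>{- int L..F}. c m) \<le> V (real k) * 1"
    using V_ge_1[of "real k"] total by (intro mult_left_mono) auto
  also have "V' (real k) * ((1 - \<epsilon>) * Sm + (1 + \<epsilon>) * (\<Sum>m\<in>{0..F}. of_int m * c m)) \<le> V' (real k) * (- 2 * \<kappa>)"
  proof (rule mult_left_mono)
    have "(1 - \<epsilon>) * Sm + (1 + \<epsilon>) * (\<Sum>m\<in>{0..F}. of_int m * c m) \<le> (1 - \<epsilon>) * Sm + (1 + \<epsilon>) * Sp"
      using Sp_ge \<epsilon> by (intro add_left_mono mult_left_mono) auto
    \<comment> \<open>Here \<open>(1 - \<epsilon>) * Sm + (1 + \<epsilon>) * Sp\<close> equals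
      \<open>(1 - \<epsilon>) * (Sm + Sp) + 2 * \<epsilon> * Sp\<close>, which explains the form of
      the mean condition.\<close>
    also have "\<dots> \<le> - 2 * \<kappa>"
      using mean unfolding S Sp_def[symmetric] by (simp add: algebra_simps)
    finally show "(1 - \<epsilon>) * Sm + (1 + \<epsilon>) * (\<Sum>m\<in>{0..F}. of_int m * c m) \<le> - 2 * \<kappa>" .
  qed (use V'_pos[of "real k"] in simp)
  \<comment> \<open>One of the two terms \<open>\<kappa> * V' k\<close> pays for the tail, the other
    is the drift that remains.\<close>
  finally have X: "X + \<kappa> * V' (real k) + \<kappa> * V' (real k) \<le> V (real k)" by (simp add: algebra_simps)
  have "(\<integral>\<^sup>+y. ennreal (V (real (fst y))) \<partial>p)
      = (\<Sum>\<^sub>\<infinity>m\<in>{- int L..}. ennreal (V (real k + of_int m) * c m))"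
    unfolding int[where g = "\<lambda>l. ennreal (V (real l))"]
  proof (rule infsum_cong)
    fix m assume m: "m \<in> {- int L..}"
    then have "real (nat (int k + m)) = real k + of_int m" using L by simp
    then show "ennreal (c m) * ennreal (V (real (nat (int k + m)))) = ennreal (V (real k + of_int m) * c m)"
      using c_nonneg V_nonneg[of m] m by (simp add: ennreal_mult mult.commute)
  qed
  also have "\<dots> = (\<Sum>\<^sub>\<infinity>m\<in>{- int L..F}. ennreal (V (real k + of_int m) * c m))
      + (\<Sum>\<^sub>\<infinity>m\<in>{F + 1..}. ennreal (V (real k + of_int m) * c m))"
    unfolding split by (rule infsum_Un_disjoint) (auto intro: nonneg_summable_on_complete)
  also have "(\<Sum>\<^sub>\<infinity>m\<in>{- int L..F}. ennreal (V (real k + of_int m) * c m)) = ennreal X"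
    unfolding X_def by (subst sum_ennreal[symmetric]) (auto intro!: mult_nonneg_nonneg V_nonneg c_nonneg)
  also have "ennreal X + (\<Sum>\<^sub>\<infinity>m\<in>{F + 1..}. ennreal (V (real k + of_int m) * c m)) + ennreal (\<kappa> * V' (real k))
      \<le> ennreal X + ennreal (\<kappa> * V' (real k)) + ennreal (\<kappa> * V' (real k))"
    using tail unfolding F_def by (intro add_mono order_refl)
  also have "\<dots> \<le> ennreal (V (real k))"
    using X X_nonneg \<kappa> V'_pos[of "real k"]
    by (simp add: ennreal_plus[symmetric] ennreal_leI del: ennreal_plus)
  finally show ?thesis by simp
qed

text \<open>Integrating the drift against \<open>q\<close> cancels the mean of \<open>V\<close> on
  both sides; bounded levels keep this mean finite, so the cancellation is legitimate in
  \<open>ennreal\<close>. What remains bounds the mean of \<open>\<kappa> * V'\<close> by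
  \<open>b\<close>, and level \<open>n\<close> contributes a part of it.\<close>

lemma level_prob_le:
  fixes q :: "(nat \<times> 'd) pmf"
  assumes stat: "bind_pmf q k = q" and fin: "set_pmf q \<subseteq> {y. fst y \<le> n}" and \<kappa>: "0 < \<kappa>" and b: "0 \<le> b"
    and drift: "\<And>x. (\<integral>\<^sup>+y. ennreal (V (real (fst y))) \<partial>k x) + ennreal (\<kappa> * V' (real (fst x)))
      \<le> ennreal (V (real (fst x))) + ennreal b"
  shows "emeasure q {y. fst y = n} \<le> ennreal (b / (\<kappa> * V' (real n)))"
proof -
  define I where "I = (\<integral>\<^sup>+x. ennreal (V (real (fst x))) \<partial>q)"
  have "I \<le> (\<integral>\<^sup>+x. ennreal (V (real n)) \<partial>q)"
    unfolding I_def using fin by (intro nn_integral_mono_AE) (auto simp: AE_measure_pmf_iff intro!: ennreal_leI V_le)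
  then have I: "I \<noteq> top" by (auto simp: top_unique measure_pmf.emeasure_space_1)
  have "I + (\<integral>\<^sup>+x. ennreal (\<kappa> * V' (real (fst x))) \<partial>q)
      = (\<integral>\<^sup>+x. \<integral>\<^sup>+y. ennreal (V (real (fst y))) \<partial>k x \<partial>q) + (\<integral>\<^sup>+x. ennreal (\<kappa> * V' (real (fst x))) \<partial>q)"
    by (simp only: nn_integral_bind_pmf[symmetric] stat I_def)
  also have "\<dots> = (\<integral>\<^sup>+x. (\<integral>\<^sup>+y. ennreal (V (real (fst y))) \<partial>k x) + ennreal (\<kappa> * V' (real (fst x))) \<partial>q)"
    by (rule nn_integral_add[symmetric]) auto
  also have "\<dots> \<le> (\<integral>\<^sup>+x. ennreal (V (real (fst x))) + ennreal b \<partial>q)"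
    by (intro nn_integral_mono drift)
  also have "\<dots> = I + ennreal b"
    by (simp add: nn_integral_add I_def measure_pmf.emeasure_space_1)
  finally have le: "(\<integral>\<^sup>+x. ennreal (\<kappa> * V' (real (fst x))) \<partial>q) \<le> ennreal b"
    using I by (simp add: ennreal_add_left_cancel_le)
  have pos: "0 < \<kappa> * V' (real n)" using \<kappa> V'_pos[of "real n"] by simp
  have "ennreal (\<kappa> * V' (real n)) * emeasure q {y. fst y = n}
      = (\<integral>\<^sup>+x. ennreal (\<kappa> * V' (real n)) * indicator {y. fst y = n} x \<partial>q)"
    by (simp add: nn_integral_cmult)
  also have "\<dots> \<le> (\<integral>\<^sup>+x. ennreal (\<kappa> * V' (real (fst x))) \<partial>q)"
    by (intro nn_integral_mono) (auto simp: indicator_def)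
  also note le
  finally have le': "\<kappa> * V' (real n) * measure_pmf.prob q {y. fst y = n} \<le> b"
    using pos b by (simp add: measure_pmf.emeasure_eq_measure ennreal_mult[symmetric])
  then have "measure_pmf.prob q {y. fst y = n} \<le> b / (\<kappa> * V' (real n))"
    using pos by (simp add: field_simps)
  then show ?thesis
    by (simp add: measure_pmf.emeasure_eq_measure ennreal_leI)
qed

text \<open>Two drift conditions are at work: the one with defect \<open>b\<close> bounds the
  truncated stationary mass at level \<open>n\<close>, the one for \<open>u\<close> bounds survival.
  Both pass from \<open>K\<close> to the truncated kernel by domination, as the functions involved
  increase with the level.\<close>

lemma l1_truncation_bound:
  fixes K :: "nat \<times> 'd::finite \<Rightarrow> (nat \<times> 'd) pmf" and n :: nat and u :: "nat \<Rightarrow> real"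
  defines "K' \<equiv> \<lambda>x. map_pmf (map_prod (min n) id) (K x)"
  assumes mono: "monotone_kernel K" and irred: "\<And>x y. \<exists>r. y \<in> set_pmf (kernel_pow K r x)"
    and p: "bind_pmf p K = p" and q: "bind_pmf q K' = q"
    and \<kappa>: "0 < \<kappa>" and b: "0 \<le> b"
    and drift: "\<And>x. (\<integral>\<^sup>+y. ennreal (V (real (fst y))) \<partial>kernel_pow K M x) + ennreal (\<kappa> * V' (real (fst x)))
      \<le> ennreal (V (real (fst x))) + ennreal b"
    and \<eta>: "0 < \<eta>" and u0: "0 \<le> u 0" and u_pos: "\<And>l. 0 < l \<Longrightarrow> 0 < u l"
    and u_mono: "\<And>k l. k \<le> l \<Longrightarrow> u k \<le> u l"
    and u_drift: "\<And>x. fst x \<noteq> 0 \<Longrightarrow>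
      (\<integral>\<^sup>+y. ennreal (V (u (fst y))) \<partial>kernel_pow K M x) + ennreal (\<eta> * V' (u (fst x))) \<le> ennreal (V (u (fst x)))"
  shows "l1_dist (pmf q) (pmf p)
    \<le> 4 * (V (u 1) / (\<eta> * V' (\<eta> * real m))) + 2 * real m * real M * (b / (\<kappa> * V' (real n)))"
proof (rule stationary_l1_bound[OF mono p _ q])
  show mono': "monotone_kernel K'" unfolding K'_def by (rule monotone_kernel_level_trunc[OF mono])
  have dom: "dominated_kernel (kernel_pow K' M) (kernel_pow K M)"
    by (intro dominated_kernel_pow mono) (simp add: K'_def dominated_kernel_level_trunc)
  show "map_pmf snd p = map_pmf snd q"
    by (rule stationary_phases_eq[OF mono p mono' q _ irred]) (simp add: K'_def map_pmf_comp)
  show "(\<integral>\<^sup>+x. survival (kernel_pow K M) m x \<partial>p) \<le> ennreal (V (u 1) / (\<eta> * V' (\<eta> * real m)))"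
    by (intro survival_bound monotone_kernel_pow mono bind_kernel_pow_stationary p \<eta> u0 u_pos u_drift)
  have u_nonneg: "0 \<le> u l" for l using u0 u_mono[of 0 l] by simp
  show "(\<integral>\<^sup>+x. survival (kernel_pow K' M) m x \<partial>q) \<le> ennreal (V (u 1) / (\<eta> * V' (\<eta> * real m)))"
  proof (rule survival_bound[where u = u, OF monotone_kernel_pow[OF mono'] bind_kernel_pow_stationary[OF q] \<eta> u0 u_pos])
    fix x :: "nat \<times> 'd" assume x: "fst x \<noteq> 0"
    have "(\<integral>\<^sup>+y. ennreal (V (u (fst y))) \<partial>kernel_pow K' M x) \<le> (\<integral>\<^sup>+y. ennreal (V (u (fst y))) \<partial>kernel_pow K M x)"
      by (intro dominated_kernelD[OF dom] level_mono_fst V_le u_nonneg u_mono)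
    then show "(\<integral>\<^sup>+y. ennreal (V (u (fst y))) \<partial>kernel_pow K' M x) + ennreal (\<eta> * V' (u (fst x))) \<le> ennreal (V (u (fst x)))"
      using u_drift[OF x] by (meson add_right_mono order_trans)
  qed
  show "(\<integral>\<^sup>+y. g y \<partial>K' x) \<le> (\<integral>\<^sup>+y. g y \<partial>K x) + emeasure (K x) {y. n < fst y}"
    if "\<And>y. g y \<le> 1" for g x
    unfolding K'_def using that by (rule level_trunc_perturbation)
  show "level_mono (\<lambda>x. emeasure (K x) {y. n < fst y})"
  proof -
    have "level_mono (indicator {y. n < fst y} :: nat \<times> 'd \<Rightarrow> ennreal)"
      by (auto simp: level_mono_def indicator_def)
    from monotone_kernelD[OF mono this] show ?thesis by simp
  qed
  show "(\<integral>\<^sup>+x. emeasure (K x) {y. n < fst y} \<partial>q) \<le> ennreal (b / (\<kappa> * V' (real n)))"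
  proof (rule order_trans[OF level_trunc_error_stationary])
    show "bind_pmf q (\<lambda>x. map_pmf (map_prod (min n) id) (K x)) = q" using q by (simp only: K'_def)
    show "emeasure q {y. fst y = n} \<le> ennreal (b / (\<kappa> * V' (real n)))"
    proof (rule level_prob_le[OF bind_kernel_pow_stationary[OF q] _ \<kappa> b])
      have "set_pmf q = set_pmf (bind_pmf q K')" by (simp only: q)
      also have "\<dots> \<subseteq> {y. fst y \<le> n}" by (auto simp: K'_def)
      finally show "set_pmf q \<subseteq> {y. fst y \<le> n}" .
      fix x :: "nat \<times> 'd"
      have "(\<integral>\<^sup>+y. ennreal (V (real (fst y))) \<partial>kernel_pow K' M x) \<le> (\<integral>\<^sup>+y. ennreal (V (real (fst y))) \<partial>kernel_pow K M x)"
        by (intro dominated_kernelD[OF dom] level_mono_fst V_le) auto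
      then show "(\<integral>\<^sup>+y. ennreal (V (real (fst y))) \<partial>kernel_pow K' M x) + ennreal (\<kappa> * V' (real (fst x)))
          \<le> ennreal (V (real (fst x))) + ennreal b"
        using drift[of x] by (meson add_right_mono order_trans)
    qed
  qed
  show "0 \<le> V (u 1) / (\<eta> * V' (\<eta> * real m))"
    using V_ge_1[of "u 1"] u_nonneg[of 1] \<eta> V'_pos[of "\<eta> * real m"] by (intro divide_nonneg_pos) auto
  show "0 \<le> b / (\<kappa> * V' (real n))"
    using b \<kappa> V'_pos[of "real n"] by (intro divide_nonneg_pos) auto
qed

end

text \<open>Each of the finitely many constraints is a lower bound of the set, hence of its infimum,
  so \<open>b\<close> itself satisfies them. As \<open>b\<close> is real, none of the series can be
  infinite.\<close>

lemma drift_const_le: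
  fixes P :: "'d::finite bmat" and b :: real
  assumes k: "\<And>x y. pmf (k x) y = P x y" and b: "ereal b = drift_const \<phi> V P K"
    and V: "\<And>l. 0 \<le> V (real l)" and \<phi>: "0 \<le> \<phi> (V (real l))"
  shows "0 \<le> b"
    and "l \<le> K \<Longrightarrow> (\<integral>\<^sup>+y. ennreal (V (real (fst y))) \<partial>k (l, i)) + ennreal (\<phi> (V (real l)))
      \<le> ennreal (V (real l)) + ennreal b"
proof -
  have "0 \<le> ereal b"
    unfolding b drift_const_def by (intro Inf_greatest) auto
  then show b0: "0 \<le> b" by simp
  assume l: "l \<le> K"
  define I where "I = (\<integral>\<^sup>+y. ennreal (V (real (fst y))) \<partial>k (l, i))"
  have "(\<Sum>\<^sub>\<infinity>m. ennreal (V (real m) * (blk P l m *v 1) $ i)) = I"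
    unfolding I_def nn_integral_level[where g = "\<lambda>m. ennreal (V (real m))"]
      infsum_ennreal_eq_nn_integral_count_space
  proof (rule nn_integral_cong)
    fix m
    have "(blk P l m *v 1) $ i = (\<Sum>j\<in>UNIV. pmf (k (l, i)) (m, j))"
      by (simp add: matrix_vector_mult_def blk_def k)
    then show "ennreal (V (real m) * (blk P l m *v 1) $ i)
        = ennreal (\<Sum>j\<in>UNIV. pmf (k (l, i)) (m, j)) * ennreal (V (real m))"
      using V[of m] by (simp add: ennreal_mult sum_nonneg mult.commute)
  qed
  then have "enn2ereal I - ereal (V (real l)) + ereal (\<phi> (V (real l))) \<le> ereal b"
    unfolding b drift_const_def using l by (intro Inf_greatest) auto
  moreover have "I \<noteq> top"
    using calculation by (auto simp: top_ennreal.rep_eq)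
  then obtain J where J: "I = ennreal J" "0 \<le> J" by (cases I rule: ennreal_cases) auto
  ultimately have "J + \<phi> (V (real l)) \<le> V (real l) + b" by (simp add: enn2ereal_ennreal)
  then show "I + ennreal (\<phi> (V (real l))) \<le> ennreal (V (real l)) + ennreal b"
    using J V[of l] \<phi> b0 by (simp add: ennreal_plus[symmetric] ennreal_leI del: ennreal_plus)
qed

lemma ennreal_le_mult_of_divide_le:
  fixes T :: ennreal
  assumes "T / ennreal v \<le> ennreal c" "0 < v" "0 \<le> c"
  shows "T \<le> ennreal (c * v)"
proof (cases T rule: ennreal_cases)
  case (real r)
  then have "r / v \<le> c" using assms by (simp add: divide_ennreal)
  then show ?thesis using real assms by (simp add: field_simps ennreal_leI)
next
  case top
  then show ?thesis using assms by (simp add: ennreal_top_divide top_unique)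
qed

theorem theorem5p1:
  fixes A :: "int \<Rightarrow> real^'d::finite^'d" and B :: "nat \<Rightarrow> real^'d^'d"
    and P P\<^sub>N :: "'d bmat" and C :: "int \<Rightarrow> real^'d^'d"
    and w :: "'d \<Rightarrow> real" and \<pi> :: "nat \<times> 'd \<Rightarrow> real"
    and V V' V'' \<phi> :: "real \<Rightarrow> real"
    and \<alpha> \<kappa> \<epsilon> \<delta>\<^sub>0 b \<beta> :: real and N M K\<^sub>0 K :: nat
  assumes A_nonneg: "\<And>k i j. 0 \<le> A k $ i $ j"
    and B_nonneg: "\<And>k i j. 0 \<le> B k $ i $ j"
    and P_eq: "P = GIG1 A B"
    and P_BM: "block_monotone P"
    and P_irred: "irreducible_mat P"
    and A_stoch: "stochastic_mat (\<lambda>i j. (\<Sum>\<^sub>\<infinity>k. A k) $ i $ j)"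
    and A_irred: "irreducible_mat (\<lambda>i j. (\<Sum>\<^sub>\<infinity>k. A k) $ i $ j)"
    and w_stat: "stationary_prob (\<lambda>i j. (\<Sum>\<^sub>\<infinity>k. A k) $ i $ j) w"
    and sigma_neg: "mean_drift w A < 0"
    and \<pi>_stat: "stationary_prob P \<pi>"
    and N_pos: "1 \<le> N"
    and sigma_N_neg: "mean_drift w (trunc_A N A) < 0"
    and P\<^sub>N_eq: "P\<^sub>N = GIG1 (trunc_A N A) B"
    and M_pos: "1 \<le> M"
    and C_eq: "C = conv_pow (trunc_A N A) M"
    and C_mean_neg: "\<And>i. (\<Sum>\<^sub>\<infinity>l\<in>{- int (M * N)..}. of_int l * (C l *v 1) $ i) < 0"
    and moments: "moment_assumption V V' V'' \<alpha> A C"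
    and \<kappa>_pos: "0 < \<kappa>" and \<epsilon>_range: "0 < \<epsilon>" "\<epsilon> < 1"
    and cond1: "\<And>i. (1 - \<epsilon>) * (\<Sum>\<^sub>\<infinity>l\<in>{- int (M * N)..}. of_int l * (C l *v 1) $ i)
                  + 2 * \<epsilon> * (\<Sum>\<^sub>\<infinity>l\<in>{0..}. of_int l * (C l *v 1) $ i) \<le> - 2 * \<kappa>"
    and \<delta>\<^sub>0_pos: "0 < \<delta>\<^sub>0" and K\<^sub>0_ge: "M * N \<le> K\<^sub>0"
    and cond2: "\<And>k. K\<^sub>0 + 1 \<le> k \<Longrightarrow>
                  V' (real k + \<delta>\<^sub>0 * real k powr (1 - \<alpha>)) \<le> (1 + \<epsilon>) * V' (real k)"
               "\<And>k. K\<^sub>0 + 1 \<le> k \<Longrightarrow> (1 - \<epsilon>) * V' (real k) \<le> V' (real k - real (M * N))"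
    and K_ge: "K\<^sub>0 \<le> K"
    and cond3: "\<And>k i. K + 1 \<le> k \<Longrightarrow> tail_moment V V' \<alpha> C \<delta>\<^sub>0 k i \<le> ennreal \<kappa>"
    and V_inv_total: "{1..} \<subseteq> V ` {0..}"
    and \<phi>_eq: "\<phi> = phi_of \<kappa> V V'"
    and b_eq: "ereal b = drift_const \<phi> V (mat_pow P\<^sub>N M) K"
    and PM_pos: "\<And>i. 0 < (blk (mat_pow P M) K 0 *v 1) $ i"
    and \<beta>_pos: "0 < \<beta>"
    and \<beta>_ge: "\<And>i. b \<le> \<beta> * (blk (mat_pow P M) K 0 *v 1) $ i"
  shows "(\<forall>m\<ge>1. \<forall>n\<ge>1. \<forall>\<pi>\<^sub>n. stationary_prob (lc_trunc n P) \<pi>\<^sub>n \<longrightarrow>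
            l1_dist \<pi>\<^sub>n \<pi> \<le>
              8 * inverse (c_fun \<phi> \<beta> 1) / r_fun \<phi> (c_fun \<phi> \<beta> (real m - 1)) * (V 1 + \<beta>)
              + 2 * real m * real M * b * real CARD('d) / (\<kappa> * V' (real n)))
       \<and> (K = 0 \<longrightarrow> (\<forall>m\<ge>1. \<forall>n\<ge>1. \<forall>\<pi>\<^sub>n. stationary_prob (lc_trunc n P) \<pi>\<^sub>n \<longrightarrow>
            l1_dist \<pi>\<^sub>n \<pi> \<le>
              8 / r_fun \<phi> (real m - 1) * V 1
              + 2 * real m * real M * b * real CARD('d) / (\<kappa> * V' (real n))))"
proof -
  interpret drift_function V V' V''
    using moments V_inv_total by unfold_locales (auto simp: moment_assumption_def)
  obtain k where k: "\<And>x y. pmf (k x) y = P x y"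
    using P_BM stochastic_mat_kernel[of P] unfolding block_monotone_def by metis
  have mono: "monotone_kernel k"
    by (intro monotone_kernelI block_monotone_kernel[OF k P_BM])
  have monoM: "monotone_kernel (kernel_pow k M)" by (rule monotone_kernel_pow[OF mono])
  have A_sum: "A summable_on S" for S by (rule summable_of_stochastic_sum[OF A_stoch])
  \<comment> \<open>A step of \<open>P\<^sub>N\<close> is a step of \<open>P\<close> followed by
    raising the target to at least \<open>k - N\<close>, where \<open>k\<close> is the level left;
    domination is then immediate.\<close>
  define kN where "kN x = map_pmf (map_prod (max (fst x - N)) id) (k x)" for x
  have kN: "pmf (kN x) y = P\<^sub>N x y" for x y
    unfolding kN_def P\<^sub>N_eq by (rule GIG1_trunc_kernel[OF _ A_sum]) (use k P_eq N_pos in auto)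
  have domN: "dominated_kernel (kernel_pow k M) (kernel_pow kN M)"
    by (intro dominated_kernel_pow' mono) (simp add: kN_def[abs_def] dominated_kernel_level_lift)
  have \<phi>V: "\<phi> (V x) = \<kappa> * V' x" if "0 \<le> x" for x
    by (rule phi_V[OF \<kappa>_pos \<phi>_eq that])
  have V_pos: "0 < V x" if "0 \<le> x" for x using V_ge_1[OF that] by simp
  have b: "0 \<le> b"
    and near: "l \<le> K \<Longrightarrow> (\<integral>\<^sup>+y. ennreal (V (real (fst y))) \<partial>kernel_pow kN M (l, i)) + ennreal (\<phi> (V (real l)))
      \<le> ennreal (V (real l)) + ennreal b" for l i
    by (rule drift_const_le[OF mat_pow_eq_pmf[OF kN, symmetric] b_eq];
        use V_pos V'_pos \<kappa>_pos in \<open>auto simp: \<phi>V less_imp_le\<close>)+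
  have far: "(\<integral>\<^sup>+y. ennreal (V (real (fst y))) \<partial>kernel_pow kN M (l, i)) + ennreal (\<kappa> * V' (real l))
      \<le> ennreal (V (real l))" if l: "K < l" for l i
  proof (rule drift_above)
    have L: "M * N < l" using l K\<^sub>0_ge K_ge by simp
    have C: "pmf (kernel_pow kN M (l, i)) (l', j) = C (int l' - int l) $ i $ j" for l' j
      unfolding C_eq by (rule kernel_pow_eq_conv_pow[OF _ A_sum _ L]) (use kN P\<^sub>N_eq N_pos in auto)
    show "(\<Sum>j\<in>UNIV. pmf (kernel_pow kN M (l, i)) (l', j)) = (C (int l' - int l) *v 1) $ i" for l'
      by (simp add: C matrix_vector_mult_def)
    show C_0: "(C m *v 1) $ i = 0" if "m < - int (M * N)" for m
      using conv_pow_trunc_A_eq_0[OF that, of A] by (simp add: C_eq)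
    \<comment> \<open>Nonnegativity is read off the transition probabilities from level
      \<open>l\<close>: every jump \<open>m \<ge> - M * N\<close> leads to a natural level.\<close>
    show "0 \<le> (C m *v 1) $ i" for m
    proof (cases "m < - int (M * N)")
      case False
      then have "m = int (nat (m + int l)) - int l" using L by linarith
      then have "C m $ i $ j = pmf (kernel_pow kN M (l, i)) (nat (m + int l), j)" for j
        using C[of "nat (m + int l)" j] by simp
      then show ?thesis by (simp add: matrix_vector_mult_def sum_nonneg)
    qed (simp add: C_0)
    show "M * N < l" by (rule L)
    \<comment> \<open>Convergence is hidden in the sign: a divergent series would have value
      \<open>0\<close>, which is not negative.\<close>
    show "(\<lambda>m. of_int m * (C m *v 1) $ i) summable_on {- int (M * N)..}"
      using C_mean_neg[of i] infsum_not_exists by fastforce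
    show "0 < \<epsilon>" by (rule \<epsilon>_range)
    show "0 \<le> \<delta>\<^sub>0 * real l powr (1 - \<alpha>)" using \<delta>\<^sub>0_pos by simp
    show "0 < \<kappa>" by (rule \<kappa>_pos)
    show "(1 - \<epsilon>) * (\<Sum>\<^sub>\<infinity>m\<in>{- int (M * N)..}. of_int m * (C m *v 1) $ i)
        + 2 * \<epsilon> * (\<Sum>\<^sub>\<infinity>m\<in>{0..}. of_int m * (C m *v 1) $ i) \<le> - 2 * \<kappa>"
      by (rule cond1)
    show "V' (real l + \<delta>\<^sub>0 * real l powr (1 - \<alpha>)) \<le> (1 + \<epsilon>) * V' (real l)"
      "(1 - \<epsilon>) * V' (real l) \<le> V' (real l - real (M * N))"
      using l K_ge by (intro cond2; simp)+
    show "(\<Sum>\<^sub>\<infinity>m\<in>{\<lfloor>\<delta>\<^sub>0 * real l powr (1 - \<alpha>)\<rfloor> + 1..}. ennreal (V (real l + of_int m) * (C m *v 1) $ i))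
        \<le> ennreal (\<kappa> * V' (real l))"
      using cond3[of l i] l \<kappa>_pos V'_pos[of "real l"] unfolding tail_moment_def
      by (intro ennreal_le_mult_of_divide_le) auto
  qed
  have V_dom: "(\<integral>\<^sup>+y. ennreal (V (real (fst y))) \<partial>kernel_pow k M x)
      \<le> (\<integral>\<^sup>+y. ennreal (V (real (fst y))) \<partial>kernel_pow kN M x)" for x
    by (intro dominated_kernelD[OF domN] level_mono_fst V_le) auto
  have drift_near: "(\<integral>\<^sup>+y. ennreal (V (real (fst y))) \<partial>kernel_pow k M x) + ennreal (\<kappa> * V' (real (fst x)))
      \<le> ennreal (V (real (fst x))) + ennreal b" if "fst x \<le> K" for x
    using near[OF that, of "snd x"] V_dom[of x] by (auto simp: \<phi>V intro: order_trans add_right_mono)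
  have drift_far: "(\<integral>\<^sup>+y. ennreal (V (real (fst y))) \<partial>kernel_pow k M x) + ennreal (\<kappa> * V' (real (fst x)))
      \<le> ennreal (V (real (fst x)))" if "K < fst x" for x
    using far[OF that, of "snd x"] V_dom[of x] by (auto intro: order_trans add_right_mono)
  have drift: "(\<integral>\<^sup>+y. ennreal (V (real (fst y))) \<partial>kernel_pow k M x) + ennreal (\<kappa> * V' (real (fst x)))
      \<le> ennreal (V (real (fst x))) + ennreal b" for x
    using drift_near[of x] drift_far[of x] by (cases "fst x \<le> K") (auto intro: order_trans)
  have irred: "\<exists>r. y \<in> set_pmf (kernel_pow k r x)" for x y
  proof -
    obtain r where "0 < mat_pow P r x y" using P_irred unfolding irreducible_mat_def by blast
    then show ?thesis by (intro exI[of _ r]) (simp add: set_pmf_iff mat_pow_eq_pmf[OF k])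
  qed
  obtain p where "\<And>x. pmf p x = \<pi> x" "bind_pmf p k = p"
    using stationary_prob_pmf[OF k \<pi>_stat] by blast
  then have p: "\<pi> = pmf p" "bind_pmf p k = p" by (simp_all add: fun_eq_iff)
  have bound: "l1_dist \<pi>\<^sub>n \<pi> \<le> 8 * (V (u 1) / (\<eta> * V' (\<eta> * (real m - 1))))
      + 2 * real m * real M * b * real CARD('d) / (\<kappa> * V' (real n))"
    if m: "1 \<le> m" and \<pi>\<^sub>n: "stationary_prob (lc_trunc n P) \<pi>\<^sub>n"
      and \<eta>: "0 < \<eta>" and u0: "0 \<le> u 0" and u_pos: "\<And>l. 0 < l \<Longrightarrow> 0 < u l"
      and u_mono: "\<And>k l. k \<le> l \<Longrightarrow> u k \<le> u l"
      and u_drift: "\<And>x. fst x \<noteq> 0 \<Longrightarrow>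
        (\<integral>\<^sup>+y. ennreal (V (u (fst y))) \<partial>kernel_pow k M x) + ennreal (\<eta> * V' (u (fst x))) \<le> ennreal (V (u (fst x)))"
    for m n \<pi>\<^sub>n \<eta> and u :: "nat \<Rightarrow> real"
  proof -
    obtain q where "\<And>x. pmf q x = \<pi>\<^sub>n x" "bind_pmf q (\<lambda>x. map_pmf (map_prod (min n) id) (k x)) = q"
      using stationary_prob_pmf[OF lc_trunc_kernel[OF k] \<pi>\<^sub>n] by blast
    then have q: "\<pi>\<^sub>n = pmf q" "bind_pmf q (\<lambda>x. map_pmf (map_prod (min n) id) (k x)) = q"
      by (simp_all add: fun_eq_iff)
    have "l1_dist \<pi>\<^sub>n \<pi> \<le> 4 * (V (u 1) / (\<eta> * V' (\<eta> * real m)))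
        + 2 * real m * real M * (b / (\<kappa> * V' (real n)))"
      unfolding p(1) q(1)
      by (rule l1_truncation_bound[OF mono irred p(2) q(2) \<kappa>_pos b drift \<eta> u0 u_pos u_mono u_drift])
    also have "\<dots> \<le> 8 * (V (u 1) / (\<eta> * V' (\<eta> * (real m - 1))))
        + 2 * real m * real M * (b / (\<kappa> * V' (real n))) * real CARD('d)"
    proof (rule add_mono)
      have Vu: "0 < V (u 1)" using u_pos[of 1] by (intro V_pos) simp
      have pos: "0 < V' (\<eta> * (real m - 1))" using \<eta> m by (intro V'_pos) simp
      have "V' (\<eta> * (real m - 1)) \<le> V' (\<eta> * real m)" using \<eta> m by (intro V'_mono) auto
      then have "V (u 1) / (\<eta> * V' (\<eta> * real m)) \<le> V (u 1) / (\<eta> * V' (\<eta> * (real m - 1)))"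
        using Vu pos \<eta> by (intro divide_left_mono mult_left_mono mult_pos_pos) auto
      moreover have "0 \<le> V (u 1) / (\<eta> * V' (\<eta> * (real m - 1)))"
        using Vu pos \<eta> by (intro divide_nonneg_pos) auto
      ultimately show "4 * (V (u 1) / (\<eta> * V' (\<eta> * real m))) \<le> 8 * (V (u 1) / (\<eta> * V' (\<eta> * (real m - 1))))"
        by linarith
      have "0 \<le> 2 * real m * real M * (b / (\<kappa> * V' (real n)))"
        using b \<kappa>_pos V'_pos[of "real n"] by simp
      moreover have "1 \<le> real CARD('d)" by (simp add: Suc_le_eq)
      ultimately show "2 * real m * real M * (b / (\<kappa> * V' (real n)))
          \<le> 2 * real m * real M * (b / (\<kappa> * V' (real n))) * real CARD('d)"
        using mult_left_mono[of 1 "real CARD('d)" "2 * real m * real M * (b / (\<kappa> * V' (real n)))"] by linarith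
    qed
    finally show ?thesis by simp
  qed
  have r_fun: "r_fun \<phi> t = \<kappa> * V' (\<kappa> * t)" if "0 \<le> t" for t
    by (rule r_fun_eq[OF \<kappa>_pos \<phi>_eq that])
  show ?thesis
  proof (intro conjI allI impI)
    fix m n :: nat and \<pi>\<^sub>n assume m: "1 \<le> m" and \<pi>\<^sub>n: "stationary_prob (lc_trunc n P) \<pi>\<^sub>n"
    define c where "c = c_fun \<phi> \<beta> 1"
    \<comment> \<open>Chosen such that \<open>V (u l)\<close> is \<open>V l + \<beta>\<close> off
      level \<open>0\<close> and \<open>V 0\<close> at level \<open>0\<close>.\<close>
    define u where "u l = (if l = 0 then 0 else V_inv (V (real l) + \<beta>))" for l :: nat
    have \<phi>_pos: "0 < \<phi> t" if "1 \<le> t" for t by (rule phi_pos[OF \<kappa>_pos \<phi>_eq that])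
    have c: "0 < c" unfolding c_def c_fun_def using \<phi>_pos[of 1] \<phi>_pos[of "\<beta> + 1"] \<beta>_pos by simp
    have c_fun: "c_fun \<phi> \<beta> t = c * t" for t by (simp add: c_def c_fun_def)
    have V\<beta>: "1 \<le> V (real l) + \<beta>" for l :: nat using V_ge_1[of "real l"] \<beta>_pos by simp
    have u_ge: "real l \<le> u l" for l
      using V_inv_le[of "V (real l)" "V (real l) + \<beta>"] V_ge_1[of "real l"] \<beta>_pos
      by (auto simp: u_def V_inv_V)
    have Vu: "V (u l) = (if l = 0 then V 0 else V (real l) + \<beta>)" for l
      by (simp add: u_def V_V_inv V\<beta>)
    have u_mono: "u j \<le> u l" if "j \<le> l" for j l
    proof (cases "j = 0")
      case True
      then show ?thesis using u_ge[of l] by (simp add: u_def)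
    next
      case False
      then show ?thesis using that V_ge_1 by (auto simp: u_def intro!: V_inv_le V\<beta> V_le)
    qed
    have "l1_dist \<pi>\<^sub>n \<pi> \<le> 8 * (V (u 1) / ((c * \<kappa>) * V' ((c * \<kappa>) * (real m - 1))))
        + 2 * real m * real M * b * real CARD('d) / (\<kappa> * V' (real n))"
    proof (rule bound[OF m \<pi>\<^sub>n _ _ _ u_mono])
      show "0 < c * \<kappa>" using c \<kappa>_pos by simp
      show "0 \<le> u 0" by (simp add: u_def)
      show "0 < u l" if "0 < l" for l using u_ge[of l] that by simp
      fix x :: "nat \<times> 'd" assume x: "fst x \<noteq> 0"
      define l where "l = fst x"
      define h where "h j = measure_pmf.prob (kernel_pow k M j) {y. fst y \<noteq> 0}" for j
      have "(\<integral>\<^sup>+y. ennreal (V (u (fst y))) \<partial>kernel_pow k M x)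
          = (\<integral>\<^sup>+y. ennreal (V (real (fst y))) + ennreal \<beta> * indicator {y. fst y \<noteq> 0} y \<partial>kernel_pow k M x)"
        using \<beta>_pos V_pos by (intro nn_integral_cong) (auto simp: Vu ennreal_plus less_imp_le indicator_def)
      also have "\<dots> = (\<integral>\<^sup>+y. ennreal (V (real (fst y))) \<partial>kernel_pow k M x) + ennreal (\<beta> * h x)"
        using \<beta>_pos by (simp add: nn_integral_add nn_integral_cmult h_def measure_pmf.emeasure_eq_measure ennreal_mult)
      finally have int: "(\<integral>\<^sup>+y. ennreal (V (u (fst y))) \<partial>kernel_pow k M x)
          = (\<integral>\<^sup>+y. ennreal (V (real (fst y))) \<partial>kernel_pow k M x) + ennreal (\<beta> * h x)" .
      \<comment> \<open>Passing from \<open>l\<close> to \<open>u l\<close> raises the required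
        drift; the factor \<open>c\<close> compensates for it.\<close>
      have "\<phi> (V (real l) + \<beta>) = \<kappa> * V' (u l)"
        using x by (simp add: \<phi>_eq phi_of_def u_def l_def)
      moreover have "c * \<phi> (V (real l) + \<beta>) \<le> \<phi> (V (real l))"
        unfolding c_def by (rule c_fun_phi_le[OF \<kappa>_pos \<phi>_eq]) (use \<beta>_pos in auto)
      ultimately have rate: "c * \<kappa> * V' (u l) \<le> \<kappa> * V' (real l)" by (simp add: \<phi>V mult.assoc)
      have h01: "0 \<le> h j" "h j \<le> 1" for j by (auto simp: h_def)
      have "(\<integral>\<^sup>+y. ennreal (V (real (fst y))) \<partial>kernel_pow k M x) + ennreal (\<kappa> * V' (real l)) + ennreal (\<beta> * h x)
          \<le> ennreal (V (real l)) + ennreal \<beta>"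
      proof (cases "l \<le> K")
        case True
        \<comment> \<open>By monotonicity, level \<open>K\<close> is the worst among the levels up
          to \<open>K\<close>, so the condition on the row \<open>K\<close> of \<open>P^M\<close>
          provides the return probability for all of them.\<close>
        have hK: "h x \<le> h (K, snd x)"
        proof -
          have "level_mono (indicator {y. fst y \<noteq> 0} :: nat \<times> 'd \<Rightarrow> ennreal)"
            by (auto simp: level_mono_def indicator_def)
          from level_monoD[OF monotone_kernelD[OF monoM this] True, of "snd x"] show ?thesis
            by (simp add: h_def l_def measure_pmf.emeasure_eq_measure)
        qed
        have "(blk (mat_pow P M) K 0 *v 1) $ snd x = 1 - h (K, snd x)"
        proof -
          have "(blk (mat_pow P M) K 0 *v 1) $ snd x = (\<Sum>j\<in>UNIV. pmf (kernel_pow k M (K, snd x)) (0, j))"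
            by (simp add: matrix_vector_mult_def blk_def mat_pow_eq_pmf[OF k])
          also have "\<dots> = sum (pmf (kernel_pow k M (K, snd x))) (Pair 0 ` UNIV)"
            by (subst sum.reindex) (auto simp: inj_on_def)
          also have "\<dots> = measure_pmf.prob (kernel_pow k M (K, snd x)) (Pair 0 ` UNIV)"
            by (rule measure_measure_pmf_finite[symmetric]) simp
          also have "Pair 0 ` (UNIV :: 'd set) = UNIV - {y. fst y \<noteq> 0}" by auto
          also have "measure_pmf.prob (kernel_pow k M (K, snd x)) \<dots> = 1 - h (K, snd x)"
            unfolding h_def using measure_pmf.prob_compl[of "{y. fst y \<noteq> 0}" "kernel_pow k M (K, snd x)"] by simp
          finally show ?thesis .
        qed
        then have "b \<le> \<beta> * (1 - h (K, snd x))" using \<beta>_ge[of "snd x"] by simp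
        also have "\<dots> \<le> \<beta> * (1 - h x)" using hK \<beta>_pos by (intro mult_left_mono) auto
        finally have bh: "b + \<beta> * h x \<le> \<beta>" by (simp add: algebra_simps)
        have "(\<integral>\<^sup>+y. ennreal (V (real (fst y))) \<partial>kernel_pow k M x) + ennreal (\<kappa> * V' (real l)) + ennreal (\<beta> * h x)
            \<le> ennreal (V (real l)) + ennreal b + ennreal (\<beta> * h x)"
          using drift[of x] unfolding l_def by (rule add_right_mono)
        also have "\<dots> \<le> ennreal (V (real l)) + ennreal \<beta>"
          unfolding add.assoc using b bh h01 \<beta>_pos
          by (intro add_left_mono) (simp add: ennreal_plus[symmetric] ennreal_leI del: ennreal_plus)
        finally show ?thesis .
      next
        case False
        have "\<beta> * h x \<le> \<beta> * 1" using h01 \<beta>_pos by (intro mult_left_mono) auto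
        then show ?thesis
          using drift_far[of x] False unfolding l_def by (intro add_mono) (auto intro: ennreal_leI)
      qed
      moreover have "ennreal (c * \<kappa> * V' (u l)) \<le> ennreal (\<kappa> * V' (real l))"
        using rate by (rule ennreal_leI)
      moreover have "ennreal (V (u l)) = ennreal (V (real l)) + ennreal \<beta>"
        using x \<beta>_pos V_pos[of "real l"] by (simp add: Vu l_def less_imp_le)
      ultimately show "(\<integral>\<^sup>+y. ennreal (V (u (fst y))) \<partial>kernel_pow k M x) + ennreal (c * \<kappa> * V' (u (fst x)))
          \<le> ennreal (V (u (fst x)))"
        unfolding int l_def[symmetric]
        by (simp only: add.assoc) (subst add.commute[of "ennreal (\<beta> * h x)"], meson add_left_mono add_right_mono order_trans)
    qed
    also have "V (u 1) = V 1 + \<beta>" by (simp add: Vu)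
    also have "8 * ((V 1 + \<beta>) / ((c * \<kappa>) * V' ((c * \<kappa>) * (real m - 1))))
        = 8 * inverse (c_fun \<phi> \<beta> 1) / r_fun \<phi> (c_fun \<phi> \<beta> (real m - 1)) * (V 1 + \<beta>)"
      using c m by (simp add: c_fun r_fun divide_inverse mult_ac)
    finally show "l1_dist \<pi>\<^sub>n \<pi> \<le> 8 * inverse (c_fun \<phi> \<beta> 1) / r_fun \<phi> (c_fun \<phi> \<beta> (real m - 1)) * (V 1 + \<beta>)
        + 2 * real m * real M * b * real CARD('d) / (\<kappa> * V' (real n))" .
  next
    fix m n :: nat and \<pi>\<^sub>n
    \<comment> \<open>All levels except \<open>0\<close> now lie above \<open>K\<close>, so
      \<open>V\<close> itself has a drift without defect off level \<open>0\<close>.\<close>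
    assume K0: "K = 0" and m: "1 \<le> m" and \<pi>\<^sub>n: "stationary_prob (lc_trunc n P) \<pi>\<^sub>n"
    have "l1_dist \<pi>\<^sub>n \<pi> \<le> 8 * (V (real 1) / (\<kappa> * V' (\<kappa> * (real m - 1))))
        + 2 * real m * real M * b * real CARD('d) / (\<kappa> * V' (real n))"
      using K0 \<kappa>_pos by (intro bound[OF m \<pi>\<^sub>n, where u = real] drift_far) auto
    then show "l1_dist \<pi>\<^sub>n \<pi> \<le> 8 / r_fun \<phi> (real m - 1) * V 1
        + 2 * real m * real M * b * real CARD('d) / (\<kappa> * V' (real n))"
      using m by (simp add: r_fun)
  qed
qed

end
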